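(* Let $p$ be a prime, let $k,\ell$ be positive integers, and write $q:=p^k$ and $Q:=p^\ell$. Let $a,b,c,d\in\mathbb{F}_{q^2}$ be not all zero, and write $A(X):=aX^{Q+1}+bX^Q+cX+d$ and $B(X):=d^qX^{Q+1}+c^qX^Q+b^qX+a^q$. Then the following are equivalent: (1) $A(X)$ has no roots in $\mu_{q+1}$ and $g(X):=B(X)/A(X)$ permutes $\mu_{q+1}$; (2) all of the following hold: $p=2$; the element $e:=a^{q+1}+b^{q+1}+c^{q+1}+d^{q+1}$ is nonzero; $(ab^q+cd^q)^Q=e^{Q-1}(ac^q+bd^q)$; and, writing $m$ for the largest integer of the form $2^i$ (with $i\ge 0$) which divides $\gcd(k,\ell)$, $$\mathrm{Tr}_{\mathbb{F}_q/\mathbb{F}_{2^m}}\Bigl(\frac{b^{q+1}+c^{q+1}}{e}\Bigr)=\frac{\mathrm{lcm}(k,\ell)}{m};$$ (3) $p=2$ and $A(X)=\delta A_0(\gamma X)$ for some $\gamma\in\mu_{q+1}$, some $\delta\in\mathbb{F}_{q^2}^*$, and some $A_0(X)\in\mathbb{F}_{q^2}[X]$ such that one of the following holds: (i) $\mathrm{ord}_2(k)\le\mathrm{ord}_2(\ell)$ and there exist $\alpha,\beta\in\mathbb{F}_{q^2}\setminus\mathbb{F}_q$ for which $$A_0(X)=(\alpha^{Q+1}+\beta)X^{Q+1}+(\alpha^{q+Q}+\beta)X^Q+(\alpha^{qQ+1}+\beta)X+(\alpha^{qQ+q}+\beta);$$ (ii) $\mathrm{ord}_2(k)\ne\mathrm{ord}_2(\ell)$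 and either $A_0(X)=X^{Q+1}$ or there exist $\alpha,\beta\in\mathbb{F}_{q^2}\setminus\mu_{q+1}$ for which $$A_0(X)=(\alpha^{qQ+q}+\beta)X^{Q+1}+(\alpha^{qQ}+\alpha\beta)X^Q+(\alpha^q+\alpha^Q\beta)X+(1+\alpha^{Q+1}\beta);$$ (iii) $\mathrm{ord}_2(k)\ge\mathrm{ord}_2(\ell)$ and either $A_0(X)=X^Q$ or there exist $\alpha,\beta\in\mathbb{F}_{q^2}\setminus\mu_{q+1}$ for which $$A_0(X)=(\alpha^{qQ}+\alpha^q\beta)X^{Q+1}+(\alpha^{qQ+1}+\beta)X^Q+(1+\alpha^{q+Q}\beta)X+(\alpha+\alpha^Q\beta).$$
   Context: $\mu_{q+1}$ is the set of $(q+1)$-th roots of unity in $\mathbb{F}_{q^2}^*$. For a positive integer $n$, $\mathrm{ord}_2(n)$ is the largest integer $i\ge 0$ with $2^i\mid n$. "$g(X)$ permutes $\mu_{q+1}$" means that $\alpha\mapsto g(\alpha)$ is a bijection of $\mu_{q+1}$ onto itself. When $p=2$, $e$ and $b^{q+1}+c^{q+1}$ lie in $\mathbb{F}_q$; $\mathrm{Tr}_{\mathbb{F}_q/\mathbb{F}_{2^m}}$ is the trace map, and the integer $\mathrm{lcm}(k,\ell)/m$ is viewed as an element of $\mathbb{F}_2\subseteq\mathbb{F}_{2^m}$. *)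

theory Defs
  imports "HOL-Computational_Algebra.Computational_Algebra" "HOL-Library.Cardinality"
begin

definition mu :: "nat \<Rightarrow> 'a::field set" where
  "mu n = {x. x ^ n = 1}"

(* For a field with q^2 elements this is the copy of F_q inside it: see subfield_of_order_props. *)
definition subfield_of_order :: "nat \<Rightarrow> 'a::field set" where
  "subfield_of_order q = {x. x ^ q = x}"

(* The trace map from the field with r^n elements to the field with r elements,
   as the sum of the conjugates. *)
definition ff_trace :: "nat \<Rightarrow> nat \<Rightarrow> 'a::field \<Rightarrow> 'a" where
  "ff_trace r n x = (\<Sum>i<n. x ^ (r ^ i))"

(* a X^(Q+1) + b X^Q + c X + d *)
definition quadrinomial :: "nat \<Rightarrow> 'a \<Rightarrow> 'a \<Rightarrow> 'a \<Rightarrow> 'a \<Rightarrow> 'a::field poly" where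
  "quadrinomial Q a b c d = monom a (Q + 1) + monom b Q + monom c 1 + monom d 0"

definition max_pow2_dvd :: "nat \<Rightarrow> nat" where
  "max_pow2_dvd n = Max {j. (\<exists>i. j = 2 ^ i) \<and> j dvd n}"

lemma CHAR_of_card:
  assumes "prime p" "CARD('a::finite_field) = p ^ n"
  shows "CHAR('a) = p"
proof -
  have pr: "prime CHAR('a)" by simp
  have "(\<Sum>x\<in>UNIV. x + 1) = (\<Sum>x\<in>UNIV. x :: 'a)"
    by (rule sum.reindex_bij_witness[of _ "\<lambda>x. x - 1" "\<lambda>x. x + 1"]) auto
  then have "of_nat CARD('a) = (0 :: 'a)" by (simp add: sum.distrib)
  then have "CHAR('a) dvd CARD('a)" by (simp add: of_nat_eq_0_iff_char_dvd)
  then have "CHAR('a) dvd p" using assms pr prime_dvd_power by metis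
  then show ?thesis using assms(1) pr primes_dvd_imp_eq by blast
qed

lemma subfield_of_order_props:
  fixes q :: nat
  defines "K \<equiv> subfield_of_order q :: 'a::finite_field set"
  assumes p: "prime p" and k: "k > 0" and q: "q = p ^ k" and card: "CARD('a) = q ^ 2"
  shows "card K = q" and "0 \<in> K" and "1 \<in> K"
    and "\<And>x y. x \<in> K \<Longrightarrow> y \<in> K \<Longrightarrow> x - y \<in> K"
    and "\<And>x y. x \<in> K \<Longrightarrow> y \<in> K \<Longrightarrow> x * y \<in> K"
    and "\<And>x. x \<in> K \<Longrightarrow> inverse x \<in> K"
proof -
  have C: "CHAR('a) = p"
    using CHAR_of_card[OF p, of "k * 2"] card q by (simp add: power_mult)
  have q1: "q > 1" using p k q by (metis one_less_power prime_gt_1_nat)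
  have add: "(x + y) ^ q = x ^ q + y ^ q" for x y :: 'a
    using freshmans_dream'[where ?'a='a, of q k x y] C p q by simp
  have neg: "(x - y) ^ q = x ^ q - y ^ q" for x y :: 'a
    using add[of "x - y" y] by simp
  show "0 \<in> K" "1 \<in> K" using q1 by (auto simp: K_def subfield_of_order_def)
  show "\<And>x y. x \<in> K \<Longrightarrow> y \<in> K \<Longrightarrow> x - y \<in> K"
    by (simp add: K_def subfield_of_order_def neg)
  show "\<And>x y. x \<in> K \<Longrightarrow> y \<in> K \<Longrightarrow> x * y \<in> K"
    by (simp add: K_def subfield_of_order_def power_mult_distrib)
  show "\<And>x. x \<in> K \<Longrightarrow> inverse x \<in> K"
    by (simp add: K_def subfield_of_order_def power_inverse)
  let ?h = "\<lambda>x::'a. x ^ q - x"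
  have KP: "K = {x. poly (monom 1 q - monom 1 1) x = 0}"
    by (simp add: K_def subfield_of_order_def poly_monom)
  have nz: "monom 1 q - monom 1 1 \<noteq> (0 :: 'a poly)"
    using q1 by (metis coeff_monom eq_iff_diff_eq_0 nat_neq_iff zero_neq_one)
  have dg: "degree (monom 1 q - monom 1 1 :: 'a poly) \<le> q"
    using q1 by (intro degree_diff_le order.trans[OF degree_monom_le]) auto
  have le: "card K \<le> q"
    using card_poly_roots_bound[OF nz] dg unfolding KP by linarith
  \<comment> \<open>the image of \<open>?h\<close> consists of roots of \<open>X ^ q + X\<close> and its fibres are cosets of \<open>K\<close>\<close>
  let ?R = "{x::'a. poly (monom 1 q + monom 1 1) x = 0}"
  have qq: "(x ^ q) ^ q = x" for x :: 'a
    using finite_field_power_card_eq_same[of x] card by (simp add: power_mult power2_eq_square)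
  have imR: "range ?h \<subseteq> ?R"
    using qq by (auto simp: poly_monom neg)
  have nz': "monom 1 q + monom 1 1 \<noteq> (0 :: 'a poly)"
  proof
    assume "monom 1 q + monom 1 1 = (0 :: 'a poly)"
    then have "coeff (monom 1 q + monom 1 1 :: 'a poly) q = 0" by simp
    then show False using q1 by simp
  qed
  have dg': "degree (monom 1 q + monom 1 1 :: 'a poly) \<le> q"
    using q1 by (intro degree_add_le order.trans[OF degree_monom_le]) auto
  have "card (range ?h) \<le> card ?R"
    by (rule card_mono[OF finite imR])
  also have "\<dots> \<le> q" using card_poly_roots_bound[OF nz'] dg' by linarith
  finally have imle: "card (range ?h) \<le> q" .
  have fib: "card {x. ?h x = v} \<le> card K" for v
  proof (cases "\<exists>u. ?h u = v")
    case True
    then obtain u where u: "?h u = v" by blast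
    show ?thesis
      by (rule card_inj_on_le[of "\<lambda>x. x - u"])
        (use u in \<open>auto simp: inj_on_def K_def subfield_of_order_def neg algebra_simps\<close>)
  qed simp
  have "UNIV = (\<Union>v\<in>range ?h. {x. ?h x = v})" by auto
  then have "q ^ 2 \<le> (\<Sum>v\<in>range ?h. card {x. ?h x = v})"
    using card card_UN_le[of "range ?h" "\<lambda>v. {x. ?h x = v}"] by simp
  also have "\<dots> \<le> card (range ?h) * card K"
    using sum_bounded_above[of "range ?h" "\<lambda>v. card {x. ?h x = v}" "card K"] fib by simp
  also have "\<dots> \<le> q * card K" using imle by simp
  finally have "q \<le> card K" using q1 by (simp add: power2_eq_square)
  with le show "card K = q" by simp
qed

end

theory Submission
  imports Defs
begin

text \<open>
Write \<open>cj x = x ^ q\<close> and \<open>fr x = x ^ Q\<close>. The function \<open>g = B / A\<close> maps each element of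
\<open>mu (q + 1)\<close> at which \<open>A\<close> does not vanish into \<open>mu (q + 1)\<close>. For a scalar \<open>u\<close>, the quadrinomial
\<open>u A - B\<close> splits as \<open>f(X)^Q h(X)\<close> with linear \<open>f\<close>, \<open>h\<close> exactly when its 2 by 2 coefficient matrix
is singular, i.e. when \<open>u\<close> is a root of a quadratic which is self-conjugate, hence has a root in the field.

Suppose \<open>g\<close> permutes \<open>mu (q + 1)\<close>. If \<open>u\<close> lies in \<open>mu (q + 1)\<close>, injectivity forces
\<open>u A - B\<close> to be a multiple of \<open>(X - x)^(Q + 1)\<close>, and nonvanishing of \<open>A\<close> at \<open>x\<close> makes \<open>u\<close> a simple root, so
there is a second root of the same kind. Otherwise \<open>g\<close> is equivalent to the product of
\<open>f(X)^Q\<close> and \<open>h(X)\<close>, each divided by its reciprocal conjugate; after moving the root of \<open>f\<close> to \<open>0\<close>, the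
vanishing of the sum of all values forces the root of \<open>h\<close> to be \<open>0\<close> or infinity. So \<open>g\<close> is equivalent to
\<open>X^(Q + 1)\<close> on the projective line over the field with \<open>q\<close> elements, or to \<open>X^(Q + 1)\<close> or \<open>X^(Q - 1)\<close> on
\<open>mu (q + 1)\<close>. The element \<open>-1\<close> shows that \<open>p = 2\<close>, and coprimality of the exponents gives the
conditions on the 2-adic valuations.

In characteristic two the three forms are recognised from the coefficients: with
\<open>W = (a b^q + c d^q) / e\<close> and \<open>z\<close> a root of \<open>z^2 + z = W W^q\<close>, the equation in (2) says that
\<open>(b^(q+1) + c^(q+1)) / e\<close> equals \<open>z + z^Q\<close> or \<open>z + z^Q + 1\<close> and that \<open>A\<close> is a combination of products of Frobenius
twists of \<open>W X + z\<close> and \<open>W X + z + 1\<close>. Telescoping the trace of \<open>z + z^Q\<close> translates the trace condition into the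
conditions on the valuations.
\<close>

section \<open>Fibre counting, exponents of two and composition with a linear monomial\<close>

lemma card_le_of_fibres:
  assumes "finite T" "f ` S \<subseteq> T" "\<And>y. y \<in> T \<Longrightarrow> card {x \<in> S. f x = y} \<le> c"
  shows "card S \<le> c * card T"
proof -
  have "S = (\<Union>y\<in>T. {x \<in> S. f x = y})" using assms(2) by auto
  then have "card S \<le> (\<Sum>y\<in>T. card {x \<in> S. f x = y})"
    using card_UN_le[OF assms(1), of "\<lambda>y. {x \<in> S. f x = y}"] by simp
  also have "\<dots> \<le> (\<Sum>y\<in>T. c)" using assms(3) by (rule sum_mono)
  finally show ?thesis by (simp add: mult.commute)
qed

lemma surj_onto_of_fibres:
  assumes "finite T" "f ` S \<subseteq> T" "\<And>y. y \<in> T \<Longrightarrow> card {x \<in> S. f x = y} \<le> c"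
    and "c > 0" "card S \<ge> c * card T"
  shows "f ` S = T"
proof (rule ccontr)
  assume "f ` S \<noteq> T"
  then have "card (f ` S) < card T"
    using assms by (intro psubset_card_mono) auto
  moreover have "card S \<le> c * card (f ` S)"
    using assms by (intro card_le_of_fibres) (auto intro: finite_subset)
  ultimately show False using assms by (metis le_trans mult_le_cancel1 not_le)
qed

lemma card_roots_power_le:
  fixes y :: "'a::idom"
  assumes "n > 0"
  shows "finite {x. x ^ n = y}" "card {x. x ^ n = y} \<le> n"
proof -
  let ?P = "monom 1 n - [:y:]"
  have nz: "?P \<noteq> 0"
    using assms by (metis coeff_monom coeff_pCons_0 degree_monom_eq degree_pCons_0 eq_iff_diff_eq_0
        less_irrefl one_neq_zero)
  have eq: "{x. x ^ n = y} = {x. poly ?P x = 0}" by (auto simp: poly_monom)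
  have "degree ?P \<le> n"
    by (intro degree_diff_le) (auto simp: degree_monom_le)
  then show "card {x. x ^ n = y} \<le> n"
    unfolding eq using card_poly_roots_bound[OF nz] by linarith
  show "finite {x. x ^ n = y}" unfolding eq using poly_roots_finite[OF nz] .
qed

lemma card_quadratic_roots_le:
  fixes r y :: "'a::idom"
  shows "card {x. x ^ 2 + r * x = y} \<le> 2"
proof -
  have eq: "{x. x ^ 2 + r * x = y} = {x. poly [:-y, r, 1:] x = 0}"
    by (auto simp: algebra_simps power2_eq_square add_eq_0_iff)
  show ?thesis unfolding eq using card_poly_roots_bound[of "[:-y, r, 1:]"] by simp
qed

section \<open>Exponents of two in integers and periods of Frobenius maps\<close>

lemma odd_div_iff_multiplicity:
  fixes d n :: nat
  assumes "d dvd n" "n > 0"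
  shows "odd (n div d) \<longleftrightarrow> multiplicity 2 n = multiplicity 2 d"
proof -
  obtain c where c: "n = d * c" using assms by blast
  then have nz: "d \<noteq> 0" "c \<noteq> 0" using assms by auto
  have "multiplicity 2 n = multiplicity 2 d + multiplicity 2 c"
    unfolding c by (rule prime_elem_multiplicity_mult_distrib) (use nz in auto)
  moreover have "multiplicity 2 c = 0 \<longleftrightarrow> odd c"
    using nz by (simp add: multiplicity_eq_zero_iff)
  ultimately show ?thesis using nz c by auto
qed

lemma max_pow2_dvd_eq:
  assumes "n > 0"
  shows "max_pow2_dvd n = 2 ^ multiplicity 2 n"
  unfolding max_pow2_dvd_def
proof (rule Max_eqI)
  show "finite {j. (\<exists>i. j = 2 ^ i) \<and> j dvd n}"
    by (rule finite_subset[of _ "{..n}"]) (use assms dvd_imp_le in auto)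
  show "2 ^ multiplicity 2 n \<in> {j. (\<exists>i. j = 2 ^ i) \<and> j dvd n}"
    using multiplicity_dvd by auto
  fix j assume "j \<in> {j. (\<exists>i. j = 2 ^ i) \<and> j dvd n}"
  then obtain i where "j = 2 ^ i" "2 ^ i dvd n" by auto
  then show "j \<le> 2 ^ multiplicity 2 n" using assms
    by (simp add: power_dvd_iff_le_multiplicity)
qed

lemma multiplicity2_gcd_lcm:
  fixes k l :: nat
  assumes "k > 0" "l > 0"
  shows "multiplicity 2 (gcd k l) = min (multiplicity 2 k) (multiplicity 2 l)"
    and "multiplicity 2 (lcm k l) = max (multiplicity 2 k) (multiplicity 2 l)"
  using assms by (auto simp: multiplicity_gcd multiplicity_lcm)

lemma frobenius_periodic:
  fixes r :: "'a::monoid_mult"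
  assumes "r ^ (2 ^ i) = r"
  shows "r ^ (2 ^ (i * n)) = r"
  by (induction n) (use assms in \<open>simp_all add: power_add power_mult\<close>)

text \<open>Bezout writes \<open>i * x = j * y + gcd i j\<close>, and both periods are
  absorbed.\<close>

lemma frobenius_gcd:
  fixes r :: "'a::monoid_mult"
  assumes "r ^ (2 ^ i) = r" "r ^ (2 ^ j) = r"
  shows "r ^ (2 ^ gcd i j) = r"
proof (cases "i = 0")
  case False
  then obtain x y where xy: "i * x = j * y + gcd i j" using bezout_nat by blast
  have "r = r ^ (2 ^ (i * x))" using frobenius_periodic[OF assms(1)] by simp
  also have "\<dots> = (r ^ (2 ^ (j * y))) ^ (2 ^ gcd i j)" unfolding xy by (simp add: power_add power_mult)
  also have "\<dots> = r ^ (2 ^ gcd i j)" using frobenius_periodic[OF assms(2)] by simp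
  finally show ?thesis by simp
qed (use assms in simp)

lemma pcompose_monom_linear: "pcompose (monom a n) [:0, c:] = monom (a * c ^ n) n"
  for a c :: "'a::comm_semiring_1"
proof (induction n)
  case (Suc n)
  have "pcompose (monom a (Suc n)) [:0, c:] = [:0, c:] * pcompose (monom a n) [:0, c:]"
    by (simp add: monom_Suc pcompose_pCons)
  also have "\<dots> = monom (a * c ^ Suc n) (Suc n)"
    unfolding Suc by (simp add: monom_Suc smult_monom algebra_simps)
  finally show ?case .
qed (simp add: monom_0)

lemma smult_pcompose_quadrinomial:
  "smult e (pcompose (quadrinomial Q a b c d) [:0, g:]) =
    quadrinomial Q (e * (a * (g ^ Q * g))) (e * (b * g ^ Q)) (e * (c * g)) (e * d)"
  by (simp add: quadrinomial_def pcompose_add pcompose_monom_linear smult_add_right smult_monom mult.commute)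

lemma quadrinomial_eq_iff:
  assumes "Q \<ge> 2"
  shows "quadrinomial Q a b c d = quadrinomial Q a' b' c' d' \<longleftrightarrow> a = a' \<and> b = b' \<and> c = c' \<and> d = d'"
proof
  assume eq: "quadrinomial Q a b c d = quadrinomial Q a' b' c' d'"
  have "coeff (quadrinomial Q a b c d) n = coeff (quadrinomial Q a' b' c' d') n" for n
    unfolding eq ..
  from this[of "Q + 1"] this[of Q] this[of 1] this[of 0]
  show "a = a' \<and> b = b' \<and> c = c' \<and> d = d'" using assms by (auto simp: quadrinomial_def)
qed simp

section \<open>The quadratic extension\<close>

locale quadratic_ext =
  fixes p k l q Q :: nat and ty :: "'a::finite_field itself"
  assumes p: "prime p" and k: "k > 0" and l: "l > 0"
    and q_def: "q = p ^ k" and Q_def: "Q = p ^ l"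
    and card_UNIV: "CARD('a) = q ^ 2"
begin

section \<open>Conjugation, the \<open>Q\<close>-power map and the unit circle\<close>

definition cj :: "'a \<Rightarrow> 'a" where "cj x = x ^ q"
definition circ :: "'a set" where "circ = {x. x * cj x = 1}"
definition fr :: "'a \<Rightarrow> 'a" where "fr x = x ^ Q"

lemma CHAR_eq: "CHAR('a) = p"
  using CHAR_of_card[OF p, of "k * 2"] card_UNIV q_def by (simp add: power_mult)

lemma q_ge_2: "q \<ge> 2"
  using p k q_def prime_ge_2_nat[OF p] by (metis One_nat_def Suc_leI le_trans power_increasing power_one_right
      prime_gt_0_nat)

lemma Q_ge_2: "Q \<ge> 2"
  using p l Q_def prime_ge_2_nat[OF p] by (metis One_nat_def Suc_leI le_trans power_increasing power_one_right
      prime_gt_0_nat)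

lemma cj_add [simp]: "cj (x + y) = cj x + cj y"
  using freshmans_dream'[where ?'a='a, of q k x y] CHAR_eq p by (simp add: cj_def flip: q_def)

lemma fr_add [simp]: "fr (x + y) = fr x + fr y"
  using freshmans_dream'[where ?'a='a, of Q l x y] CHAR_eq p by (simp add: fr_def flip: Q_def)

lemma cj_mult [simp]: "cj (x * y) = cj x * cj y" by (simp add: cj_def power_mult_distrib)
lemma fr_mult [simp]: "fr (x * y) = fr x * fr y" by (simp add: fr_def power_mult_distrib)
lemma cj_0 [simp]: "cj 0 = 0" using q_ge_2 by (simp add: cj_def)
lemma fr_0 [simp]: "fr 0 = 0" using Q_ge_2 by (simp add: fr_def)
lemma cj_1 [simp]: "cj 1 = 1" by (simp add: cj_def)
lemma fr_1 [simp]: "fr 1 = 1" by (simp add: fr_def)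
lemma cj_diff [simp]: "cj (x - y) = cj x - cj y" using cj_add[of "x - y" y] by simp
lemma fr_diff [simp]: "fr (x - y) = fr x - fr y" using fr_add[of "x - y" y] by simp
lemma cj_minus [simp]: "cj (- x) = - cj x" using cj_diff[of 0 x] by simp
lemma fr_minus [simp]: "fr (- x) = - fr x" using fr_diff[of 0 x] by simp
lemma cj_eq_0_iff [simp]: "cj x = 0 \<longleftrightarrow> x = 0" using q_ge_2 by (simp add: cj_def)
lemma fr_eq_0_iff [simp]: "fr x = 0 \<longleftrightarrow> x = 0" using Q_ge_2 by (simp add: fr_def)
lemma cj_inverse [simp]: "cj (inverse x) = inverse (cj x)" by (simp add: cj_def power_inverse)
lemma fr_inverse [simp]: "fr (inverse x) = inverse (fr x)" by (simp add: fr_def power_inverse)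
lemma cj_divide [simp]: "cj (x / y) = cj x / cj y" by (simp add: cj_def power_divide)
lemma fr_divide [simp]: "fr (x / y) = fr x / fr y" by (simp add: fr_def power_divide)
lemma cj_power [simp]: "cj (x ^ n) = cj x ^ n" by (simp add: cj_def flip: power_mult) (simp add: mult.commute)
lemma fr_power [simp]: "fr (x ^ n) = fr x ^ n" by (simp add: fr_def flip: power_mult) (simp add: mult.commute)
lemma cj_fr [simp]: "cj (fr x) = fr (cj x)" by (simp add: fr_def)

lemma cj_cj [simp]: "cj (cj x) = x"
  using finite_field_power_card_eq_same[of x] card_UNIV
  by (simp add: cj_def power_mult power2_eq_square)

lemma cj_eq_iff [simp]: "cj x = cj y \<longleftrightarrow> x = y"
  by (metis cj_cj)

lemma fr_eq_iff [simp]: "fr x = fr y \<longleftrightarrow> x = y"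
  using fr_eq_0_iff[of "x - y"] by (simp del: fr_eq_0_iff)

lemma fr_surj: "\<exists>y. fr y = x"
proof -
  have "inj fr" by (auto simp: inj_def)
  then have "surj fr" by (simp add: finite_UNIV_inj_surj)
  then show ?thesis by (metis surj_def)
qed

lemma mu_eq: "mu (q + 1) = circ"
  by (simp add: mu_def cj_def circ_def)

lemma circ_iff: "x \<in> circ \<longleftrightarrow> x * cj x = 1"
  by (simp add: circ_def)

lemma K_iff: "x \<in> subfield_of_order q \<longleftrightarrow> cj x = x"
  by (simp add: subfield_of_order_def cj_def)

lemma circ_nz: "x \<in> circ \<Longrightarrow> x \<noteq> 0"
  by (auto simp: circ_iff)

lemma card_K: "card {x::'a. cj x = x} = q"
  using subfield_of_order_props(1)[OF p k q_def card_UNIV]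
  by (simp add: subfield_of_order_def cj_def)

text \<open>A value has at most \<open>q + 1\<close> preimages, and
  \<open>q^2 - 1 = (q + 1) * (q - 1)\<close>, so the \<open>q^2 - 1\<close> nonzero arguments must
  reach all \<open>q - 1\<close> nonzero elements of F_q.\<close>

lemma norm_surj:
  assumes "cj y = y" "y \<noteq> 0"
  shows "\<exists>x. x * cj x = y"
proof -
  let ?T = "{x. cj x = x} - {0}"
  have cT: "card ?T = q - 1" using card_K by simp
  have "card (UNIV - {0::'a}) = q ^ 2 - 1" using card_UNIV by (simp add: card_Diff_singleton)
  also have "\<dots> = (q + 1) * (q - 1)"
    by (simp add: power2_eq_square algebra_simps)
  finally have c: "card (UNIV - {0::'a}) = (q + 1) * card ?T" using cT by simp
  have "(\<lambda>x. x * cj x) ` (UNIV - {0}) = ?T"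
  proof (rule surj_onto_of_fibres[where c = "q + 1"])
    show "(\<lambda>x. x * cj x) ` (UNIV - {0}) \<subseteq> ?T" by auto
    fix y
    have "{x \<in> UNIV - {0}. x * cj x = y} \<subseteq> {x. x ^ (q + 1) = y}" by (auto simp: cj_def)
    then have "card {x \<in> UNIV - {0}. x * cj x = y} \<le> card {x. x ^ (q + 1) = y}"
      by (intro card_mono) auto
    also have "\<dots> \<le> q + 1" by (rule card_roots_power_le) simp
    finally show "card {x \<in> UNIV - {0}. x * cj x = y} \<le> q + 1" .
  qed (use c in auto)
  then show ?thesis using assms by (metis (mono_tags, lifting) DiffI imageE mem_Collect_eq singletonD)
qed

text \<open>For the lower bound, \<open>x ^ (q - 1)\<close> sends the \<open>q^2 - 1\<close> nonzero
  elements into \<open>circ\<close> with fibres of size at most \<open>q - 1\<close>.\<close>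

lemma card_circ: "card circ = q + 1"
proof -
  let ?f = "\<lambda>x::'a. x ^ (q - 1)"
  have "card circ \<ge> q + 1"
  proof (rule ccontr)
    assume "\<not> ?thesis"
    then have lt: "card circ < q + 1" by simp
    have q1: "q - 1 > 0" using q_ge_2 by simp
    have eq: "q ^ 2 - 1 = (q - 1) * (q + 1)"
      by (simp add: power2_eq_square algebra_simps)
    have im: "?f ` (UNIV - {0}) \<subseteq> circ"
    proof (rule image_subsetI)
      fix x :: 'a assume "x \<in> UNIV - {0}"
      then have "x \<noteq> 0" by simp
      then have "x ^ (q - 1) = cj x / x" using q_ge_2 by (simp add: cj_def power_diff)
      then show "x ^ (q - 1) \<in> circ" using \<open>x \<noteq> 0\<close> by (simp add: circ_iff)
    qed
    have "card (UNIV - {0::'a}) \<le> (q - 1) * card circ"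
    proof (rule card_le_of_fibres[OF _ im])
      fix y :: 'a
      have "card {x \<in> UNIV - {0}. ?f x = y} \<le> card {x. x ^ (q - 1) = y}"
        by (intro card_mono) auto
      also have "\<dots> \<le> q - 1" using q1 by (rule card_roots_power_le)
      finally show "card {x \<in> UNIV - {0}. ?f x = y} \<le> q - 1" .
    qed simp
    also have "\<dots> < (q - 1) * (q + 1)" using lt q1 by (intro mult_strict_left_mono)
    finally show False using eq card_UNIV by (simp add: card_Diff_singleton)
  qed
  moreover have "card circ \<le> q + 1"
    using card_roots_power_le(2)[of "q + 1" "1::'a"] by (simp add: circ_def cj_def)
  ultimately show ?thesis by simp
qed

lemma ex_circ_avoiding: "finite S \<Longrightarrow> card S \<le> 2 \<Longrightarrow> \<exists>x \<in> circ. x \<notin> S"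
proof (rule ccontr)
  assume "finite S" "card S \<le> 2" "\<not> (\<exists>x \<in> circ. x \<notin> S)"
  then have "circ \<subseteq> S" by auto
  then have "card circ \<le> card S" using \<open>finite S\<close> by (rule card_mono[rotated])
  then show False using card_circ q_ge_2 \<open>card S \<le> 2\<close> by simp
qed

lemma ex_not_K: "\<exists>x. cj x \<noteq> x"
proof (rule ccontr)
  assume "\<not> ?thesis"
  then have "card (UNIV :: 'a set) = q" using card_K by simp
  then show False using card_UNIV q_ge_2 by (simp add: power2_eq_square)
qed

section \<open>Hilbert 90 and quadratic equations over F_q\<close>

text \<open>The twisted average \<open>v + inverse x * cj v\<close> satisfies the equation for every
  \<open>v\<close>. If it were always zero, \<open>v = 1\<close> would give \<open>x = -1\<close>
  and conjugation would be the identity.\<close>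

lemma hilbert90:
  assumes "x * cj x = 1"
  shows "\<exists>v. v \<noteq> 0 \<and> cj v = x * v"
proof -
  have x0: "x \<noteq> 0" using assms by auto
  have cx: "cj x = inverse x" using assms by (metis inverse_unique)
  have gen: "cj (v + inverse x * cj v) = x * (v + inverse x * cj v)" for v
    using cx x0 by (simp add: field_simps)
  show ?thesis
  proof (cases "\<exists>v. v + inverse x * cj v \<noteq> 0")
    case True then show ?thesis using gen by blast
  next
    case False
    then have *: "cj v = - x * v" for v using x0 by (simp add: field_simps add_eq_0_iff)
    from *[of 1] have "x = - 1" by (metis add.inverse_inverse cj_1 mult.right_neutral)
    with * have "cj v = v" for v by simp
    then show ?thesis using ex_not_K by blast
  qed
qed

text \<open>For odd \<open>p\<close> the discriminant is zero or a norm \<open>x ^ (q + 1)\<close>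
  with \<open>q + 1\<close> even, hence a square. For \<open>p = 2\<close>, squaring is bijective if
  \<open>r = 0\<close>, and otherwise a two-to-one count applies.\<close>

lemma quadratic_root:
  assumes "cj r = r" "cj s = s"
  shows "\<exists>v. v ^ 2 + r * v + s = 0"
proof (cases "p = 2")
  case False
  then have odd: "odd p" using p prime_odd_nat prime_gt_1_nat by (metis le_neq_implies_less prime_ge_2_nat)
  then have two: "(2::'a) \<noteq> 0"
    using CHAR_eq of_nat_eq_0_iff_char_dvd[of 2, where ?'a='a] p False
    by (metis of_nat_numeral primes_dvd_imp_eq two_is_prime_nat)
  have "odd q" using odd by (simp add: q_def)
  then obtain n where n: "q + 1 = 2 * n" by (metis even_add even_numeral dvdE odd_one)
  let ?d = "r ^ 2 - 4 * s"
  have c4: "cj 4 = 4" using cj_add[of "2" "2"] cj_add[of 1 1] by (simp del: cj_add)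
  have "\<exists>y. y ^ 2 = ?d"
  proof (cases "?d = 0")
    case False
    have "cj ?d = ?d" using assms c4 by simp
    from norm_surj[OF this False] obtain x where "x * cj x = ?d" ..
    then have "x ^ (q + 1) = ?d" by (simp add: cj_def)
    then show ?thesis unfolding n by (metis mult.commute power_mult)
  qed (metis zero_power2)
  then obtain y where y: "y ^ 2 = ?d" ..
  define t where "t = (y - r) / 2"
  have "2 * t = y - r" using two by (simp add: t_def)
  then have "y = 2 * t + r" by simp
  then have "2 * (2 * (t ^ 2 + r * t + s)) = 0"
    using y by (simp add: power2_eq_square algebra_simps)
  then have "t ^ 2 + r * t + s = 0" using two mult_eq_0_iff by blast
  then show ?thesis by blast
next
  case True
  have two: "x + x = (0::'a)" for x
    using CHAR_eq of_nat_CHAR[where ?'a='a] True by (metis mult_2 mult_zero_left of_nat_numeral)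
  show ?thesis
  proof (cases "r = 0")
    case True
    have "inj (\<lambda>x::'a. x ^ 2)"
    proof (rule injI)
      fix x y :: 'a assume "x ^ 2 = y ^ 2"
      then have "(x + y) ^ 2 = 0"
        using two[of 1] by (simp add: power2_eq_square algebra_simps)
      then have "x + y = y + y" using two by simp
      then show "x = y" by simp
    qed
    then obtain v where "v ^ 2 = s" by (metis (no_types) finite_UNIV_inj_surj finite surjD)
    then have "v ^ 2 + r * v + s = 0" using True two[of s] by simp
    then show ?thesis by blast
  next
    case False
    obtain u where u: "cj u \<noteq> u" using ex_not_K by blast
    \<comment> \<open>An element of trace \<open>r\<close>: adding it moves F_q onto the coset
      \<open>?K'\<close> where \<open>cj x = x + r\<close>.\<close>
    define y where "y = r * (u / (u + cj u))"
    have nz: "u + cj u \<noteq> 0" using u two by (metis add_right_cancel)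
    have "cj y + y = r * (cj u / (u + cj u)) + r * (u / (u + cj u))"
      using assms by (simp add: y_def add.commute)
    also have "\<dots> = r * ((u + cj u) / (u + cj u))"
      unfolding add_divide_distrib by (simp only: distrib_left add.commute)
    finally have y: "cj y + y = r" using nz by simp
    have y': "cj y = y + r" using y two[of y] by (metis add.assoc add.commute add.right_neutral)
    let ?K = "{x. cj x = x}" and ?K' = "{x. cj x = x + r}"
    have "?K' = (\<lambda>x. x + y) ` ?K"
    proof (intro equalityI subsetI)
      fix x assume "x \<in> ?K'"
      then have "cj (x - y) = x - y" using y' by simp
      then show "x \<in> (\<lambda>x. x + y) ` ?K" by (intro image_eqI[of _ _ "x - y"]) auto
    qed (auto simp: y' add.assoc)
    then have cK': "card ?K' = q" using card_K by (simp add: card_image)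
    have dis: "?K \<inter> ?K' = {}" using False by auto
    have "card (?K \<union> ?K') = 2 * card ?K"
      using dis cK' card_K by (simp add: card_Un_disjoint)
    \<comment> \<open>On \<open>?K'\<close> conjugation sends \<open>x\<close> to
      \<open>x + r\<close>, which has the same value, so values lie in F_q; \<open>2 * q\<close>
      arguments with fibres of size at most 2 exhaust it.\<close>
    have "(\<lambda>x. x ^ 2 + r * x) ` (?K \<union> ?K') = ?K"
    proof (rule surj_onto_of_fibres[where c = 2])
      show "(\<lambda>x. x ^ 2 + r * x) ` (?K \<union> ?K') \<subseteq> ?K"
      proof (rule image_subsetI)
        fix x assume "x \<in> ?K \<union> ?K'"
        then have "cj x = x \<or> cj x = x + r" by auto
        moreover have "(x + r) ^ 2 + r * (x + r) = x ^ 2 + r * x + (r * (x + r) + r * (x + r))"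
          by (simp add: power2_eq_square algebra_simps)
        ultimately show "x ^ 2 + r * x \<in> ?K" using assms two by auto
      qed
      fix y
      have "card {x \<in> ?K \<union> ?K'. x ^ 2 + r * x = y} \<le> card {x. x ^ 2 + r * x = y}"
        by (intro card_mono) auto
      also have "\<dots> \<le> 2" by (rule card_quadratic_roots_le)
      finally show "card {x \<in> ?K \<union> ?K'. x ^ 2 + r * x = y} \<le> 2" .
    qed (use \<open>card (?K \<union> ?K') = _\<close> in auto)
    then obtain v where "v ^ 2 + r * v = s" using assms by (metis (mono_tags, lifting) imageE mem_Collect_eq)
    then have "v ^ 2 + r * v + s = 0" using two[of s] by simp
    then show ?thesis by blast
  qed
qed

section \<open>Values on the unit circle and Moebius maps\<close>

definition val :: "'a \<Rightarrow> 'a \<Rightarrow> 'a \<Rightarrow> 'a \<Rightarrow> 'a \<Rightarrow> 'a" where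
  "val a b c d x = a * fr x * x + b * fr x + c * x + d"

definition permutes :: "'a \<Rightarrow> 'a \<Rightarrow> 'a \<Rightarrow> 'a \<Rightarrow> bool" where
  "permutes a b c d \<longleftrightarrow> (\<forall>x\<in>circ. val a b c d x \<noteq> 0) \<and>
     bij_betw (\<lambda>x. val (cj d) (cj c) (cj b) (cj a) x / val a b c d x) circ circ"

text \<open>\<open>A = s f(X)^Q g(X) + t h(X)^Q k(X)\<close> with \<open>f = f1 X + f2\<close>, and likewise for \<open>g\<close>, \<open>h\<close>, \<open>k\<close>.\<close>

definition two_term :: "'a \<Rightarrow> 'a \<Rightarrow> 'a \<Rightarrow> 'a \<Rightarrow> 'a \<Rightarrow> 'a \<Rightarrow> 'a \<Rightarrow> 'a \<Rightarrow> 'a \<Rightarrow> 'a \<Rightarrow> 'a \<Rightarrow> 'a \<Rightarrow> 'a \<Rightarrow> 'a \<Rightarrow> bool" where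
  "two_term a b c d s f1 f2 g1 g2 t h1 h2 k1 k2 \<longleftrightarrow>
     a = s * (fr f1 * g1) + t * (fr h1 * k1) \<and> b = s * (fr f1 * g2) + t * (fr h1 * k2) \<and>
     c = s * (fr f2 * g1) + t * (fr h2 * k1) \<and> d = s * (fr f2 * g2) + t * (fr h2 * k2)"

text \<open>On \<open>circ\<close>, \<open>cj x\<close> is the inverse of \<open>x\<close>, so
  \<open>B\<close> is the conjugate reciprocal of \<open>A\<close> there.\<close>

lemma val_cj:
  assumes "x \<in> circ"
  shows "val (cj d) (cj c) (cj b) (cj a) x = fr x * x * cj (val a b c d x)"
proof -
  have 1: "x * cj x = 1" using assms by (simp add: circ_iff)
  then have 2: "fr x * fr (cj x) = 1" by (metis fr_1 fr_mult)
  have "fr x * x * cj (val a b c d x) = cj a * (fr x * fr (cj x)) * (x * cj x) + cj b * (fr x * fr (cj x)) * x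
      + cj c * fr x * (x * cj x) + cj d * fr x * x"
    by (simp add: val_def algebra_simps)
  then show ?thesis unfolding 1 2 by (simp add: val_def)
qed

lemma circ_closed: "x \<in> circ \<Longrightarrow> fr x \<in> circ" "x \<in> circ \<Longrightarrow> y \<in> circ \<Longrightarrow> x * y \<in> circ"
  "x \<in> circ \<Longrightarrow> cj x \<in> circ" "x \<in> circ \<Longrightarrow> inverse x \<in> circ" "x \<in> circ \<Longrightarrow> y \<in> circ \<Longrightarrow> x / y \<in> circ"
  "1 \<in> circ" "x \<in> circ \<Longrightarrow> - x \<in> circ"
proof -
  show "x \<in> circ \<Longrightarrow> fr x \<in> circ" by (metis circ_iff cj_fr fr_1 fr_mult)
  show "x \<in> circ \<Longrightarrow> y \<in> circ \<Longrightarrow> x * y \<in> circ"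
    by (simp add: circ_iff mult.assoc mult.left_commute[of y])
qed (auto simp: circ_iff field_simps)

lemma cj_over_circ: "x \<noteq> 0 \<Longrightarrow> cj x / x \<in> circ"
  by (simp add: circ_iff)

lemma val_ratio_circ:
  assumes "x \<in> circ" "val a b c d x \<noteq> 0"
  shows "val (cj d) (cj c) (cj b) (cj a) x / val a b c d x \<in> circ"
proof -
  have "val (cj d) (cj c) (cj b) (cj a) x / val a b c d x = fr x * x * (cj (val a b c d x) / val a b c d x)"
    using assms by (simp add: val_cj)
  then show ?thesis using assms cj_over_circ circ_closed by metis
qed

lemma permutesI:
  assumes "\<And>x. x \<in> circ \<Longrightarrow> val a b c d x \<noteq> 0"
    and "\<And>x y. x \<in> circ \<Longrightarrow> y \<in> circ \<Longrightarrow>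
      val (cj d) (cj c) (cj b) (cj a) x * val a b c d y = val (cj d) (cj c) (cj b) (cj a) y * val a b c d x \<Longrightarrow> x = y"
  shows "permutes a b c d"
proof -
  let ?g = "\<lambda>x. val (cj d) (cj c) (cj b) (cj a) x / val a b c d x"
  have "inj_on ?g circ"
    by (rule inj_onI) (use assms in \<open>auto simp: field_simps\<close>)
  moreover have "?g ` circ \<subseteq> circ" using val_ratio_circ assms by blast
  ultimately have "bij_betw ?g circ circ" unfolding bij_betw_def
    by (metis card_image card_subset_eq finite)
  then show ?thesis unfolding permutes_def using assms(1) by blast
qed

text \<open>On \<open>circ\<close> the denominator is \<open>x * cj (r1 * x + r2)\<close>, so the
  quotient stays on \<open>circ\<close>. The difference of norms is the determinant behind
  nonvanishing and injectivity.\<close>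

lemma mobius_bij:
  assumes "r1 * cj r1 \<noteq> r2 * cj r2"
  shows "bij_betw (\<lambda>x. (r1 * x + r2) / (cj r2 * x + cj r1)) circ circ"
    and "\<And>x. x \<in> circ \<Longrightarrow> r1 * x + r2 \<noteq> 0" and "\<And>x. x \<in> circ \<Longrightarrow> cj r2 * x + cj r1 \<noteq> 0"
proof -
  show nz1: "r1 * x + r2 \<noteq> 0" if "x \<in> circ" for x
  proof
    assume "r1 * x + r2 = 0"
    then have "r2 = - r1 * x" by (simp add: add_eq_0_iff)
    then have "r2 * cj r2 = r1 * cj r1 * (x * cj x)" by simp
    then show False using that assms by (simp add: circ_iff)
  qed
  have rel: "cj r2 * x + cj r1 = x * cj (r1 * x + r2)" if "x \<in> circ" for x
    using that by (simp add: circ_iff algebra_simps)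
  show nz2: "cj r2 * x + cj r1 \<noteq> 0" if "x \<in> circ" for x
    using rel[OF that] nz1[OF that] circ_nz[OF that] by (simp del: cj_add cj_mult)
  let ?g = "\<lambda>x. (r1 * x + r2) / (cj r2 * x + cj r1)"
  have "inj_on ?g circ"
  proof (rule inj_onI)
    fix x y assume xy: "x \<in> circ" "y \<in> circ" "?g x = ?g y"
    then have "(r1 * x + r2) * (cj r2 * y + cj r1) = (r1 * y + r2) * (cj r2 * x + cj r1)"
      using nz2 by (simp add: frac_eq_eq)
    then have "(r1 * cj r1 - r2 * cj r2) * (x - y) = 0" by (simp add: algebra_simps)
    then show "x = y" using assms by simp
  qed
  moreover have "?g ` circ \<subseteq> circ"
  proof (rule image_subsetI)
    fix x assume x: "x \<in> circ"
    let ?w = "r1 * x + r2"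
    have "?g x = inverse x * inverse (cj ?w / ?w)"
      unfolding rel[OF x] by (simp add: field_simps del: cj_add cj_mult)
    then show "?g x \<in> circ" using x cj_over_circ[OF nz1[OF x]] circ_closed by metis
  qed
  ultimately show "bij_betw ?g circ circ" unfolding bij_betw_def
    by (metis card_image card_subset_eq finite)
qed

section \<open>Power sums over the unit circle\<close>

text \<open>Multiplying by some \<open>z\<close> in \<open>circ\<close> with
  \<open>z ^ j \<noteq> 1\<close> permutes the terms and scales the sum.\<close>

lemma sum_power_circ:
  assumes "0 < j" "j \<le> q"
  shows "(\<Sum>y\<in>circ. y ^ j) = 0"
proof -
  have "\<exists>z\<in>circ. z ^ j \<noteq> 1"
  proof (rule ccontr)
    assume "\<not> ?thesis"
    then have "card circ \<le> card {z::'a. z ^ j = 1}" by (intro card_mono) auto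
    also have "\<dots> \<le> j" using assms by (intro card_roots_power_le)
    finally show False using assms card_circ by simp
  qed
  then obtain z where z: "z \<in> circ" "z ^ j \<noteq> 1" by blast
  have "(\<Sum>y\<in>circ. y ^ j) = (\<Sum>y\<in>circ. (z * y) ^ j)"
    by (rule sum.reindex_bij_witness[of _ "\<lambda>y. z * y" "\<lambda>y. y / z"])
      (use z circ_nz circ_closed in auto)
  also have "\<dots> = z ^ j * (\<Sum>y\<in>circ. y ^ j)" by (simp add: power_mult_distrib sum_distrib_left)
  finally show ?thesis using z by (metis mult_cancel_right1)
qed

lemma of_nat_q: "of_nat q = (0::'a)"
  unfolding of_nat_eq_0_iff_char_dvd CHAR_eq q_def using k by (rule dvd_power[OF disjI1])

text \<open>\<open>q + 1\<close> is prime to \<open>p\<close>. This keeps the power sum of exponent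
  \<open>Q\<close> in the vanishing range after reduction modulo \<open>q + 1\<close>.\<close>

lemma q1_not_dvd_Q: "\<not> (q + 1) dvd Q"
proof
  assume *: "(q + 1) dvd Q"
  have "coprime (q + 1) q" by simp
  then have "coprime (q + 1) p" using k unfolding q_def by simp
  then have "coprime (q + 1) Q" unfolding Q_def by simp
  then have "q + 1 = 1" using * coprime_common_divisor[of "q + 1" Q "q + 1"] by simp
  then show False using q_ge_2 by simp
qed

text \<open>The sums \<open>S j\<close> of \<open>y ^ j / D y\<close> satisfy a two-term recursion whose inhomogeneity vanishes unless \<open>q + 1\<close>
  divides \<open>j\<close>; the hypothesis makes one of them, hence all of them, zero, contradicting the recursion at \<open>j = 0\<close>.\<close>

lemma power_sum_vanishes:
  assumes ne: "r1 * cj r1 \<noteq> r2 * cj r2"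
    and sum0: "(\<Sum>y\<in>circ. fr y * ((r1 * y + r2) / (cj r2 * y + cj r1))) = 0"
  shows "r1 = 0 \<or> r2 = 0"
proof (rule ccontr)
  assume "\<not> ?thesis"
  then have nz: "r1 \<noteq> 0" "r2 \<noteq> 0" "cj r1 \<noteq> 0" "cj r2 \<noteq> 0" by auto
  define D where "D y = cj r2 * y + cj r1" for y
  define S where "S j = (\<Sum>y\<in>circ. y ^ j / D y)" for j
  have D: "D y \<noteq> 0" if "y \<in> circ" for y unfolding D_def using mobius_bij(3)[OF ne that] .
  have rec: "cj r2 * S (Suc j) + cj r1 * S j = (\<Sum>y\<in>circ. y ^ j)" for j
  proof -
    have "cj r2 * S (Suc j) + cj r1 * S j = (\<Sum>y\<in>circ. y ^ j * D y / D y)"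
      unfolding S_def sum_distrib_left sum.distrib[symmetric]
      by (rule sum.cong) (simp_all add: D_def algebra_simps add_divide_distrib)
    also have "\<dots> = (\<Sum>y\<in>circ. y ^ j)" using D by (intro sum.cong) auto
    finally show ?thesis .
  qed
  have per1: "y ^ (q + 1) = 1" if "y \<in> circ" for y using that by (simp add: circ_iff cj_def)
  have per: "S j = S (j mod (q + 1))" for j
  proof -
    have "y ^ j = y ^ (j mod (q + 1))" if "y \<in> circ" for y
    proof -
      have "y ^ j = y ^ ((q + 1) * (j div (q + 1)) + j mod (q + 1))"
        by (simp only: mult_div_mod_eq)
      also have "\<dots> = y ^ (j mod (q + 1))" by (simp only: power_add[of _ _ "j mod (q + 1)"] power_mult per1[OF that] power_one mult_1_left)
      finally show ?thesis .
    qed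
    then show ?thesis unfolding S_def by (intro sum.cong) auto
  qed
  define j0 where "j0 = Q mod (q + 1)"
  have j0: "0 < j0" "j0 \<le> q" using q1_not_dvd_Q by (auto simp: j0_def dvd_eq_mod_eq_0 simp flip: less_Suc_eq_le)
  have "r1 * S (Suc Q) + r2 * S Q = (\<Sum>y\<in>circ. fr y * ((r1 * y + r2) / D y))"
    unfolding S_def sum_distrib_left sum.distrib[symmetric]
    by (rule sum.cong) (simp_all add: fr_def algebra_simps add_divide_distrib)
  then have e1: "r1 * S (Suc Q) + r2 * S Q = 0" using sum0 by (simp add: D_def)
  have e2: "cj r2 * S (Suc Q) + cj r1 * S Q = 0"
  proof -
    have "(\<Sum>y\<in>circ. y ^ Q) = (\<Sum>y\<in>circ. y ^ j0)"
    proof (rule sum.cong)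
      fix y assume "y \<in> circ"
      have "y ^ Q = y ^ ((q + 1) * (Q div (q + 1)) + j0)"
        by (simp only: j0_def mult_div_mod_eq)
      also have "\<dots> = y ^ j0" by (simp only: power_add[of _ _ j0] power_mult per1[OF \<open>y \<in> circ\<close>] power_one mult_1_left)
      finally show "y ^ Q = y ^ j0" .
    qed simp
    then show ?thesis using rec[of Q] sum_power_circ[OF j0] by simp
  qed
  \<comment> \<open>Cramer's rule for \<open>e1\<close> and \<open>e2\<close>, with determinant
    nonzero by \<open>ne\<close>.\<close>
  have "(r1 * cj r1 - r2 * cj r2) * S Q =
      r1 * (cj r2 * S (Suc Q) + cj r1 * S Q) - cj r2 * (r1 * S (Suc Q) + r2 * S Q)"
    by (simp add: algebra_simps)
  then have "S Q = 0" unfolding e1 e2 using ne by simp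
  then have Sj0: "S j0 = 0" using per[of Q] by (simp add: j0_def)
  have step: "S (Suc j) = 0 \<longleftrightarrow> S j = 0" if "0 < j" "j \<le> q" for j
    using rec[of j] sum_power_circ[OF that] nz
    by (metis add_cancel_left_left add_cancel_left_right mult_eq_0_iff)
  \<comment> \<open>\<open>S j0 = 0\<close> spreads to \<open>S 1\<close> and to
    \<open>S (q + 1) = S 0\<close>; at \<open>j = 0\<close> the recursion then equates 0 with
    \<open>q + 1\<close>, which is 1 in the field.\<close>
  have "S (Suc j) = 0 \<longleftrightarrow> S 1 = 0" if "j \<le> q" for j
    using that by (induction j) (use step in auto)
  from this[of "j0 - 1"] this[of q] Sj0 j0 have "S 1 = 0" "S (q + 1) = 0" by auto
  then have "S (Suc 0) = 0" "S 0 = 0" using per[of "q + 1"] by auto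
  then have "(\<Sum>y\<in>circ. y ^ 0) = 0" using rec[of 0] by simp
  then show False using card_circ of_nat_q by simp
qed

text \<open>Substituting the inverse \<open>m\<close> of the first Moebius map turns the product
  into \<open>fr y\<close> times a Moebius map with coefficients \<open>t1\<close>,
  \<open>t2\<close>. Bijectivity makes the values sum to zero, so \<open>t1\<close> or
  \<open>t2\<close> vanishes: the root of the second factor is that of the first or its image under
  \<open>x\<close> to \<open>1 / cj x\<close>.\<close>

lemma nonsplit_roots:
  assumes ne: "r1 * cj r1 \<noteq> r2 * cj r2" "s1 * cj s1 \<noteq> s2 * cj s2"
    and bij: "bij_betw (\<lambda>x. fr ((r1 * x + r2) / (cj r2 * x + cj r1)) * ((s1 * x + s2) / (cj s2 * x + cj s1))) circ circ"
  shows "s1 * cj r1 = s2 * cj r2 \<or> s2 * r1 = s1 * r2"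
proof -
  define m where "m y = (cj r1 * y - r2) / (r1 - cj r2 * y)" for y
  define t1 where "t1 = s1 * cj r1 - s2 * cj r2"
  define t2 where "t2 = s2 * r1 - s1 * r2"
  let ?G = "\<lambda>x. fr ((r1 * x + r2) / (cj r2 * x + cj r1)) * ((s1 * x + s2) / (cj s2 * x + cj s1))"
  have ne': "cj r1 * cj (cj r1) \<noteq> (- r2) * cj (- r2)" using ne(1) by (simp add: mult.commute)
  have mb: "bij_betw m circ circ"
    using mobius_bij(1)[OF ne'] by (simp add: m_def[abs_def])
  have nz: "r1 - cj r2 * y \<noteq> 0" if "y \<in> circ" for y
    using mobius_bij(3)[OF ne' that] by simp
  have G: "?G (m y) = fr y * ((t1 * y + t2) / (cj t2 * y + cj t1))" if y: "y \<in> circ" for y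
  proof -
    let ?n = "r1 - cj r2 * y" and ?d = "r1 * cj r1 - r2 * cj r2"
    have n: "?n \<noteq> 0" and d: "?d \<noteq> 0" using nz[OF y] ne by auto
    have 1: "r1 * m y + r2 = ?d * y / ?n" "cj r2 * m y + cj r1 = ?d / ?n"
      "s1 * m y + s2 = (t1 * y + t2) / ?n" "cj s2 * m y + cj s1 = (cj t2 * y + cj t1) / ?n"
      using n by (simp_all add: m_def t1_def t2_def field_simps)
    show ?thesis unfolding 1 using n d by simp
  qed
  have "t1 * cj t1 - t2 * cj t2 = (r1 * cj r1 - r2 * cj r2) * (s1 * cj s1 - s2 * cj s2)"
    by (simp add: t1_def t2_def algebra_simps)
  then have t: "t1 * cj t1 \<noteq> t2 * cj t2" using ne by auto
  have "(\<Sum>y\<in>circ. fr y * ((t1 * y + t2) / (cj t2 * y + cj t1))) = (\<Sum>y\<in>circ. ?G (m y))"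
    using G by (intro sum.cong) auto
  also have "\<dots> = (\<Sum>x\<in>circ. ?G x)" by (rule sum.reindex_bij_betw[OF mb])
  also have "\<dots> = (\<Sum>x\<in>circ. x)" by (rule sum.reindex_bij_betw[OF bij])
  also have "\<dots> = 0" using sum_power_circ[of 1] q_ge_2 by simp
  finally show ?thesis using power_sum_vanishes[OF t] by (auto simp: t1_def t2_def)
qed

text \<open>The determinant of the coefficient matrix of \<open>u A - B\<close>, viewed as a bilinear form in \<open>(X^Q, 1)\<close> and \<open>(X, 1)\<close>.\<close>

definition det_poly :: "'a \<Rightarrow> 'a \<Rightarrow> 'a \<Rightarrow> 'a \<Rightarrow> 'a \<Rightarrow> 'a" where
  "det_poly a b c d u = (a * d - b * c) * u ^ 2 - (a * cj a + d * cj d - b * cj b - c * cj c) * u + cj (a * d - b * c)"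

text \<open>In the split form both linear factors \<open>v X + cj v\<close> and \<open>w X + cj w\<close> have their roots in \<open>circ\<close>; in the other
  two forms the factors are \<open>v X + w\<close> and its conjugate reciprocal \<open>cj w X + cj v\<close>.\<close>

definition split_form :: "'a \<Rightarrow> 'a \<Rightarrow> 'a \<Rightarrow> 'a \<Rightarrow> 'a \<Rightarrow> 'a \<Rightarrow> 'a \<Rightarrow> 'a \<Rightarrow> bool" where
  "split_form s t v w a b c d \<longleftrightarrow> two_term a b c d s v (cj v) v (cj v) t w (cj w) w (cj w)"
definition diag_form :: "'a \<Rightarrow> 'a \<Rightarrow> 'a \<Rightarrow> 'a \<Rightarrow> 'a \<Rightarrow> 'a \<Rightarrow> 'a \<Rightarrow> 'a \<Rightarrow> bool" where
  "diag_form s t v w a b c d \<longleftrightarrow> two_term a b c d s v w v w t (cj w) (cj v) (cj w) (cj v)"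
definition anti_form :: "'a \<Rightarrow> 'a \<Rightarrow> 'a \<Rightarrow> 'a \<Rightarrow> 'a \<Rightarrow> 'a \<Rightarrow> 'a \<Rightarrow> 'a \<Rightarrow> bool" where
  "anti_form s t v w a b c d \<longleftrightarrow> two_term a b c d s v w (cj w) (cj v) t (cj w) (cj v) v w"

section \<open>The forms forced by a permutation\<close>

lemma val_two_term:
  assumes "two_term a b c d s f1 f2 g1 g2 t h1 h2 k1 k2"
  shows "val a b c d x = s * (fr (f1 * x + f2) * (g1 * x + g2)) + t * (fr (h1 * x + h2) * (k1 * x + k2))"
proof -
  have eqs: "a = s * (fr f1 * g1) + t * (fr h1 * k1)" "b = s * (fr f1 * g2) + t * (fr h1 * k2)"
     "c = s * (fr f2 * g1) + t * (fr h2 * k1)" "d = s * (fr f2 * g2) + t * (fr h2 * k2)"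
    using assms by (simp_all only: two_term_def)
  show ?thesis unfolding val_def eqs by (simp add: algebra_simps)
qed

lemma permutes_inj:
  assumes "permutes a b c d" "x \<in> circ" "y \<in> circ"
    and "val (cj d) (cj c) (cj b) (cj a) x * val a b c d y = val (cj d) (cj c) (cj b) (cj a) y * val a b c d x"
  shows "x = y"
proof -
  have "val (cj d) (cj c) (cj b) (cj a) x / val a b c d x = val (cj d) (cj c) (cj b) (cj a) y / val a b c d y"
    using assms unfolding permutes_def by (subst frac_eq_eq) auto
  then show ?thesis using assms unfolding permutes_def bij_betw_def inj_on_def by blast
qed

text \<open>A singular 2 by 2 matrix is an outer product; surjectivity of \<open>fr\<close> lets one
  vector be written as Frobenius images.\<close>

lemma rank_one_factor:
  assumes "P * T = R * (S :: 'a)"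
  shows "\<exists>f1 f2 g1 g2. P = fr f1 * g1 \<and> R = fr f1 * g2 \<and> S = fr f2 * g1 \<and> T = fr f2 * g2"
proof -
  have "\<exists>x1 x2 g1 g2. P = x1 * g1 \<and> R = x1 * g2 \<and> S = x2 * g1 \<and> T = x2 * g2"
  proof (cases "P = 0")
    case False
    then have "P = 1 * P \<and> R = 1 * R \<and> S = (S / P) * P \<and> T = (S / P) * R"
      using assms by (simp add: field_simps)
    then show ?thesis by blast
  next
    case True
    then consider "R = 0" | "S = 0" using assms by auto
    then show ?thesis
    proof cases
      case 1
      then have "P = 0 * S \<and> R = 0 * T \<and> S = 1 * S \<and> T = 1 * T" using True by simp
      then show ?thesis by blast
    next
      case 2
      then have "P = R * 0 \<and> R = R * 1 \<and> S = T * 0 \<and> T = T * 1" using True by simp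
      then show ?thesis by blast
    qed
  qed
  then show ?thesis by (metis fr_surj)
qed

lemma norm_neq_of_nonvanishing:
  assumes "\<And>x. x \<in> circ \<Longrightarrow> g1 * x + g2 \<noteq> 0"
  shows "g1 * cj g1 \<noteq> g2 * cj g2"
proof
  assume eq: "g1 * cj g1 = g2 * cj g2"
  show False
  proof (cases "g1 = 0")
    case True
    then show False using eq assms[of 1] circ_closed by simp
  next
    case False
    have "(- g2 / g1) * cj (- g2 / g1) = (g2 * cj g2) / (g1 * cj g1)" by simp
    then have "- g2 / g1 \<in> circ" using False by (simp add: circ_iff eq[symmetric])
    moreover have "g1 * (- g2 / g1) + g2 = 0" using False by simp
    ultimately show False using assms by blast
  qed
qed

text \<open>Following the permutation by \<open>(y - u) / (1 - cj u * y)\<close> gives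
  \<open>F / F'\<close>, whose numerator and denominator split into linear factors. As
  \<open>u\<close> is outside \<open>circ\<close>, none of them vanishes on \<open>circ\<close>, and
  \<open>nonsplit_roots\<close> applies.\<close>

lemma nonsplit_forms:
  assumes perm: "permutes a b c d" and u: "u \<notin> circ" and D: "det_poly a b c d u = 0"
  shows "\<exists>s t v w. v * cj v \<noteq> w * cj w \<and> s * cj s \<noteq> t * cj t \<and>
    (diag_form s t v w a b c d \<or> anti_form s t v w a b c d)"
proof -
  have nzA: "\<And>x. x \<in> circ \<Longrightarrow> val a b c d x \<noteq> 0"
    and bij: "bij_betw (\<lambda>x. val (cj d) (cj c) (cj b) (cj a) x / val a b c d x) circ circ"
    using perm by (auto simp: permutes_def)
  let ?P = "cj d - u * a" and ?R = "cj c - u * b" and ?S = "cj b - u * c" and ?T = "cj a - u * d"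
  have "?P * ?T - ?R * ?S = det_poly a b c d u"
    by (simp add: det_poly_def algebra_simps power2_eq_square)
  then obtain f1 f2 g1 g2 where PRST: "?P = fr f1 * g1" "?R = fr f1 * g2" "?S = fr f2 * g1" "?T = fr f2 * g2"
    using rank_one_factor[of ?P ?T ?R ?S] D by auto
  define F where "F x = val (cj d) (cj c) (cj b) (cj a) x - u * val a b c d x" for x
  define F' where "F' x = val a b c d x - cj u * val (cj d) (cj c) (cj b) (cj a) x" for x
  have F: "F x = fr (f1 * x + f2) * (g1 * x + g2)" for x
  proof -
    have "F x = ?P * (fr x * x) + ?R * fr x + ?S * x + ?T"
      by (simp add: F_def val_def algebra_simps)
    also have "\<dots> = fr (f1 * x + f2) * (g1 * x + g2)"
      unfolding PRST by (simp add: algebra_simps)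
    finally show ?thesis .
  qed
  have cPRST: "a - cj u * cj d = cj (fr f2 * g2)" "b - cj u * cj c = cj (fr f2 * g1)"
    "c - cj u * cj b = cj (fr f1 * g2)" "d - cj u * cj a = cj (fr f1 * g1)"
    unfolding PRST[symmetric] by simp_all
  have F': "F' x = fr (cj f2 * x + cj f1) * (cj g2 * x + cj g1)" for x
  proof -
    have "F' x = (a - cj u * cj d) * (fr x * x) + (b - cj u * cj c) * fr x + (c - cj u * cj b) * x + (d - cj u * cj a)"
      by (simp add: F'_def val_def algebra_simps)
    also have "\<dots> = fr (cj f2 * x + cj f1) * (cj g2 * x + cj g1)"
      unfolding cPRST by (simp add: algebra_simps)
    finally show ?thesis .
  qed
  have Fnz: "F x \<noteq> 0" if "x \<in> circ" for x
  proof
    assume "F x = 0"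
    then have "u = val (cj d) (cj c) (cj b) (cj a) x / val a b c d x"
      using nzA[OF that] by (simp add: F_def field_simps)
    then show False using u val_ratio_circ[OF that nzA[OF that]] by metis
  qed
  have nf: "f1 * cj f1 \<noteq> f2 * cj f2"
    by (rule norm_neq_of_nonvanishing) (use Fnz in \<open>auto simp: F simp del: fr_add fr_mult\<close>)
  have ng: "g1 * cj g1 \<noteq> g2 * cj g2"
    by (rule norm_neq_of_nonvanishing) (use Fnz in \<open>auto simp: F simp del: fr_add fr_mult\<close>)
  have u1: "1 * cj 1 \<noteq> (- u) * cj (- u)" using u by (auto simp: circ_iff)
  have "bij_betw ((\<lambda>y. (1 * y + - u) / (cj (- u) * y + cj 1)) \<circ>
      (\<lambda>x. val (cj d) (cj c) (cj b) (cj a) x / val a b c d x)) circ circ"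
    by (rule bij_betw_trans[OF bij mobius_bij(1)[OF u1]])
  also have "bij_betw ((\<lambda>y. (1 * y + - u) / (cj (- u) * y + cj 1)) \<circ>
      (\<lambda>x. val (cj d) (cj c) (cj b) (cj a) x / val a b c d x)) circ circ \<longleftrightarrow>
    bij_betw (\<lambda>x. fr ((f1 * x + f2) / (cj f2 * x + cj f1)) * ((g1 * x + g2) / (cj g2 * x + cj g1))) circ circ"
  proof (rule bij_betw_cong)
    fix x assume x: "x \<in> circ"
    let ?B = "val (cj d) (cj c) (cj b) (cj a) x" and ?A = "val a b c d x"
    have A: "?A \<noteq> 0" using nzA[OF x] .
    have "((\<lambda>y. (1 * y + - u) / (cj (- u) * y + cj 1)) \<circ> (\<lambda>x. val (cj d) (cj c) (cj b) (cj a) x / val a b c d x)) x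
      = (?B / ?A - u) / (1 - cj u * (?B / ?A))" by simp
    also have "\<dots> = ((?B - u * ?A) / ?A) / ((?A - cj u * ?B) / ?A)"
      using A by (simp add: diff_divide_distrib)
    also have "\<dots> = F x / F' x" using A by (simp add: F_def F'_def)
    also have "\<dots> = fr ((f1 * x + f2) / (cj f2 * x + cj f1)) * ((g1 * x + g2) / (cj g2 * x + cj g1))"
      unfolding F F' fr_divide by simp
    finally show "((\<lambda>y. (1 * y + - u) / (cj (- u) * y + cj 1)) \<circ> (\<lambda>x. val (cj d) (cj c) (cj b) (cj a) x / val a b c d x)) x
      = fr ((f1 * x + f2) / (cj f2 * x + cj f1)) * ((g1 * x + g2) / (cj g2 * x + cj g1))" .
  qed
  finally have "g1 * cj f1 = g2 * cj f2 \<or> g2 * f1 = g1 * f2"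
    by (rule nonsplit_roots[OF nf ng])
  define n where "n = 1 - u * cj u"
  have n: "n \<noteq> 0" using u by (auto simp: n_def circ_iff)
  have nn: "cj n = n" by (simp add: n_def mult.commute)
  \<comment> \<open>These are the coefficients of \<open>n * A = cj u * F + F'\<close>.\<close>
  have abcd: "n * a = cj u * (fr f1 * g1) + cj (fr f2 * g2)" "n * b = cj u * (fr f1 * g2) + cj (fr f2 * g1)"
    "n * c = cj u * (fr f2 * g1) + cj (fr f1 * g2)" "n * d = cj u * (fr f2 * g2) + cj (fr f1 * g1)"
    unfolding PRST[symmetric] cPRST[symmetric] by (simp_all add: n_def algebra_simps)
  have st: "(cj u * m / n) * cj (cj u * m / n) \<noteq> (cj m / n) * cj (cj m / n)" if "m \<noteq> 0" for m
  proof
    assume "(cj u * m / n) * cj (cj u * m / n) = (cj m / n) * cj (cj m / n)"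
    then have "(u * cj u) * (m * cj m) = m * cj m" using n nn by (simp add: field_simps)
    then show False using that n by (simp add: n_def)
  qed
  \<comment> \<open>A second factor proportional to the first gives \<open>diag_form\<close>; one
    proportional to its conjugate reciprocal gives \<open>anti_form\<close>.\<close>
  show ?thesis
  proof (cases "g2 * f1 = g1 * f2")
    case True
    have "\<exists>m. g1 = m * f1 \<and> g2 = m * f2"
    proof (cases "f1 = 0")
      case True
      then have "f2 \<noteq> 0" using nf by auto
      then show ?thesis using True \<open>g2 * f1 = g1 * f2\<close> by (intro exI[of _ "g2 / f2"]) auto
    next
      case False
      then show ?thesis using \<open>g2 * f1 = g1 * f2\<close> by (intro exI[of _ "g1 / f1"]) (auto simp: field_simps)
    qed
    then obtain m where m: "g1 = m * f1" "g2 = m * f2" by blast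
    have "m \<noteq> 0" using ng m by auto
    have "diag_form (cj u * m / n) (cj m / n) f1 f2 a b c d"
      unfolding diag_form_def two_term_def using abcd n m by (simp add: field_simps)
    then show ?thesis using nf st[OF \<open>m \<noteq> 0\<close>] by blast
  next
    case False
    then have g: "g1 * cj f1 = g2 * cj f2" using \<open>_ \<or> _\<close> by blast
    have "\<exists>m. g1 = m * cj f2 \<and> g2 = m * cj f1"
    proof (cases "f1 = 0")
      case True
      then have "f2 \<noteq> 0" using nf by auto
      then show ?thesis using True g by (intro exI[of _ "g1 / cj f2"]) auto
    next
      case False
      then show ?thesis using g by (intro exI[of _ "g2 / cj f1"]) (auto simp: field_simps)
    qed
    then obtain m where m: "g1 = m * cj f2" "g2 = m * cj f1" by blast
    have "m \<noteq> 0" using ng m by auto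
    have "anti_form (cj u * m / n) (cj m / n) f1 f2 a b c d"
      unfolding anti_form_def two_term_def using abcd n m by (simp add: field_simps)
    then show ?thesis using nf st[OF \<open>m \<noteq> 0\<close>] by blast
  qed
qed

text \<open>For \<open>u\<close> in \<open>circ\<close>, \<open>T = - u * cj P\<close> and
  \<open>S = - u * cj R\<close>, so singularity makes all four norms equal and puts the roots of
  both linear factors of \<open>u * A - B\<close> in \<open>circ\<close>. Both are preimages of
  \<open>u\<close>, hence equal.\<close>

lemma split_root:
  assumes perm: "permutes a b c d" and u: "u \<in> circ" and D: "det_poly a b c d u = 0"
  shows "\<exists>x\<in>circ. \<exists>P. P \<noteq> 0 \<and> u * a - cj d = P \<and> u * b - cj c = - x * P \<and> u * c - cj b = - fr x * P \<and>
    u * d - cj a = fr x * x * P"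
proof -
  let ?B = "val (cj d) (cj c) (cj b) (cj a)" and ?A = "val a b c d"
  have nzA: "\<And>x. x \<in> circ \<Longrightarrow> ?A x \<noteq> 0" and bij: "bij_betw (\<lambda>x. ?B x / ?A x) circ circ"
    using perm by (auto simp: permutes_def)
  define P where "P = u * a - cj d"
  define R where "R = u * b - cj c"
  define S where "S = u * c - cj b"
  define T where "T = u * d - cj a"
  have uu: "u * cj u = 1" using u by (simp add: circ_iff)
  have T: "T = - u * cj P" and S: "S = - u * cj R"
    using uu by (simp_all add: P_def R_def S_def T_def algebra_simps)
  have nS: "S * cj S = R * cj R" unfolding S using uu by simp
  have "P * T - R * S = det_poly a b c d u"
    by (simp add: P_def R_def S_def T_def det_poly_def algebra_simps power2_eq_square)
  then have PT: "P * T = R * S" using D by simp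
  have PR: "P * cj P = R * cj R"
  proof -
    have "u * (P * cj P) = u * (R * cj R)" using PT unfolding T S by (simp add: algebra_simps)
    then show ?thesis using circ_nz[OF u] by simp
  qed
  have W: "u * ?A x - ?B x = P * (fr x * x) + R * fr x + S * x + T" for x
    by (simp add: val_def P_def R_def S_def T_def algebra_simps)
  have uniq: "x = y" if "x \<in> circ" "y \<in> circ" "u * ?A x - ?B x = 0" "u * ?A y - ?B y = 0" for x y
  proof -
    have "?B x = u * ?A x" "?B y = u * ?A y" using that by auto
    then show ?thesis using permutes_inj[OF perm that(1,2)] by simp
  qed
  \<comment> \<open>\<open>P = 0\<close> would kill all coefficients and make the permutation
    constant.\<close>
  have P: "P \<noteq> 0"
  proof
    assume "P = 0"
    then have "R = 0" "S = 0" "T = 0" using PR S T by auto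
    then have "u * ?A x - ?B x = 0" for x unfolding W using \<open>P = 0\<close> by simp
    then have "circ \<subseteq> {1}" using uniq[OF _ circ_closed(6)] by blast
    then have "card circ \<le> card {1::'a}" by (intro card_mono) auto
    then show False using card_circ q_ge_2 by simp
  qed
  then have R: "R \<noteq> 0" and nz: "S \<noteq> 0" "cj P \<noteq> 0" using PR S circ_nz[OF u] by auto
  define x where "x = - R / P"
  have "x * cj x = (R * cj R) / (P * cj P)" by (simp add: x_def)
  then have x: "x \<in> circ" using P by (simp add: circ_iff PR[symmetric])
  obtain y where y: "fr y = - S / P" using fr_surj by blast
  have "fr (y * cj y) = (S * cj S) / (P * cj P)" unfolding fr_mult cj_fr[symmetric] y by simp
  then have "fr (y * cj y) = 1" using P by (simp add: nS PR[symmetric])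
  then have "y \<in> circ" by (metis circ_iff fr_1 fr_eq_iff)
  have fac: "u * ?A z - ?B z = P * ((fr z - fr y) * (z - x))" for z
    unfolding W y using P PT by (simp add: x_def field_simps)
  have "y = x" by (rule uniq[OF \<open>y \<in> circ\<close> x]) (simp_all add: fac)
  have "R = - x * P" "S = - fr x * P" using P y \<open>y = x\<close> by (simp_all add: x_def field_simps)
  moreover then have "T = fr x * x * P" using PT P by (simp add: field_simps)
  ultimately show ?thesis using x P unfolding P_def R_def S_def T_def by blast
qed

text \<open>The roots of \<open>det_poly\<close> have product \<open>cj ?D / ?D\<close>, so the
  second root \<open>u'\<close> is in \<open>circ\<close> too. Subtracting the factorizations at
  \<open>u\<close> and \<open>u'\<close> eliminates \<open>B\<close> and leaves \<open>A\<close> as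
  a combination of two \<open>(Q + 1)\<close>-st powers.\<close>

lemma split_forms:
  assumes perm: "permutes a b c d" and u: "u \<in> circ" and D: "det_poly a b c d u = 0"
  shows "2 * u * (a * d - b * c) \<noteq> a * cj a + d * cj d - b * cj b - c * cj c"
    and "\<exists>s t v w. v * cj w \<noteq> cj v * w \<and> split_form s t v w a b c d"
proof -
  let ?B = "val (cj d) (cj c) (cj b) (cj a)" and ?A = "val a b c d"
  have nzA: "\<And>x. x \<in> circ \<Longrightarrow> ?A x \<noteq> 0" using perm by (auto simp: permutes_def)
  let ?E = "a * cj a + d * cj d - b * cj b - c * cj c" and ?D = "a * d - b * c"
  obtain x P where x: "x \<in> circ" and P: "P \<noteq> 0"
    and eq: "u * a - cj d = P" "u * b - cj c = - x * P" "u * c - cj b = - fr x * P" "u * d - cj a = fr x * x * P"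
    using split_root[OF perm u D] by blast
  \<comment> \<open>the derivative of the quadratic at \<open>u\<close> is a multiple of the value of \<open>A\<close> at \<open>x\<close>, so \<open>u\<close> is a simple root\<close>
  have "2 * u * ?D - ?E = a * (u * d - cj a) + d * (u * a - cj d) - b * (u * c - cj b) - c * (u * b - cj c)"
    by (simp add: algebra_simps)
  also have "\<dots> = P * ?A x" unfolding eq by (simp add: val_def algebra_simps)
  finally have ne: "2 * u * ?D - ?E \<noteq> 0" using P nzA[OF x] by simp
  then show "2 * u * ?D \<noteq> ?E" by simp
  have D0: "?D * u ^ 2 - ?E * u + cj ?D = 0" using D by (simp add: det_poly_def)
  have cE: "cj ?E = ?E" by (simp add: mult.commute)
  have Dnz: "?D \<noteq> 0"
  proof
    assume "?D = 0"
    then have "?E = 0" using D0 circ_nz[OF u] by simp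
    then show False using ne \<open>?D = 0\<close> by simp
  qed
  define u' where "u' = cj ?D / (?D * u)"
  have u': "u' \<in> circ" using cj_over_circ[OF Dnz] u circ_closed(5) unfolding u'_def by (metis divide_divide_eq_left)
  have sum: "?D * u + ?D * u' = ?E"
  proof -
    have "u * (?D * u + ?D * u') = ?D * u ^ 2 + cj ?D"
      using Dnz circ_nz[OF u] by (simp add: u'_def power2_eq_square field_simps del: cj_diff cj_mult)
    also have "\<dots> = u * ?E" using D0 by (simp add: algebra_simps del: cj_diff cj_mult)
    finally show ?thesis using circ_nz[OF u] by simp
  qed
  have "u \<noteq> u'"
  proof
    assume "u = u'"
    have "2 * u * ?D = ?D * u + ?D * u" by (simp add: algebra_simps)
    also have "\<dots> = ?E" using sum unfolding \<open>u = u'\<close>[symmetric] .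
    finally show False using ne by simp
  qed
  have "?D * u'^2 - ?E * u' + cj ?D = 0"
  proof -
    have "?D * u * u' = cj ?D" using Dnz circ_nz[OF u] by (simp add: u'_def del: cj_diff cj_mult)
    then show ?thesis unfolding sum[symmetric] by (simp add: algebra_simps power2_eq_square del: cj_diff cj_mult)
  qed
  then have D': "det_poly a b c d u' = 0" by (simp only: det_poly_def)
  obtain x' P' where x': "x' \<in> circ" and P': "P' \<noteq> 0"
    and eq': "u' * a - cj d = P'" "u' * b - cj c = - x' * P'" "u' * c - cj b = - fr x' * P'" "u' * d - cj a = fr x' * x' * P'"
    using split_root[OF perm u' D'] by blast
  define r where "r = u - u'"
  have r: "r \<noteq> 0" using \<open>u \<noteq> u'\<close> by (simp add: r_def)
  have abcd: "r * a = P - P'" "r * b = - x * P + x' * P'" "r * c = - fr x * P + fr x' * P'" "r * d = fr x * x * P - fr x' * x' * P'"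
    unfolding r_def using eq eq' by (simp_all add: algebra_simps)
  \<comment> \<open>Hilbert 90 for \<open>- x\<close> turns \<open>v * (X - x)\<close> into
    \<open>v * X + cj v\<close>, the shape used in \<open>split_form\<close>.\<close>
  have "(- x) * cj (- x) = 1" "(- x') * cj (- x') = 1" using x x' by (simp_all add: circ_iff)
  then obtain v w where v: "v \<noteq> 0" "cj v = - x * v" and w: "w \<noteq> 0" "cj w = - x' * w"
    using hilbert90 by metis
  have "x \<noteq> x'"
  proof
    assume "x = x'"
    have "r * ?A x = (r * a) * (fr x * x) + (r * b) * fr x + (r * c) * x + r * d"
      by (simp add: val_def algebra_simps)
    also have "\<dots> = 0" unfolding abcd \<open>x = x'\<close> by (simp add: algebra_simps)
    finally show False using nzA[OF x] r by simp
  qed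
  then have "v * cj w \<noteq> cj v * w" using v w by simp
  moreover have "split_form (P / (r * (fr v * v))) (- P' / (r * (fr w * w))) v w a b c d"
    unfolding split_form_def two_term_def v w using abcd r v(1) w(1) by (simp add: field_simps)
  ultimately show "\<exists>s t v w. v * cj w \<noteq> cj v * w \<and> split_form s t v w a b c d" by blast
qed

text \<open>Multiplying by the leading coefficient \<open>?D\<close> and setting
  \<open>v = ?D * u\<close> gives a monic quadratic over F_q.\<close>

lemma ex_det_root: "\<exists>u. det_poly a b c d u = 0"
proof (cases "a * d - b * c = 0")
  case True
  then have "cj (a * d - b * c) = 0" by (metis cj_0)
  then have "det_poly a b c d 0 = 0" by (simp add: det_poly_def)
  then show ?thesis by blast
next
  case False
  let ?E = "a * cj a + d * cj d - b * cj b - c * cj c" and ?D = "a * d - b * c"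
  have "cj (- ?E) = - ?E" "cj (?D * cj ?D) = ?D * cj ?D" by (simp_all add: mult.commute)
  then obtain v where "v ^ 2 + (- ?E) * v + ?D * cj ?D = 0" using quadratic_root by blast
  moreover have "D * (D * (v / D) ^ 2 - E * (v / D) + z) = v ^ 2 + (- E) * v + D * z" if "D \<noteq> 0" for D E z
    using that by (simp add: field_simps power2_eq_square)
  then have "?D * det_poly a b c d (v / ?D) = v ^ 2 + (- ?E) * v + ?D * cj ?D"
    unfolding det_poly_def using False by blast
  ultimately show ?thesis using False by (metis mult_eq_0_iff)
qed

section \<open>Ratios that a permutation must trivialize\<close>

text \<open>On \<open>circ\<close>, \<open>B / A\<close> depends only on
  \<open>(f x / h x) ^ (Q + 1)\<close>. Multiplying \<open>f / h\<close> by \<open>r\<close> keeps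
  this power, so it moves \<open>y\<close> to a point \<open>x\<close> with the same value.\<close>

lemma split_ratio_trivial:
  assumes perm: "permutes a b c d" and form: "split_form s t v w a b c d" and ne: "v * cj w \<noteq> cj v * w"
    and r: "cj r = r" "fr r * r = 1"
  shows "r = 1"
proof -
  let ?B = "val (cj d) (cj c) (cj b) (cj a)" and ?A = "val a b c d"
  define f where "f x = v * x + cj v" for x
  define h where "h x = w * x + cj w" for x
  have vw: "v \<noteq> 0" "w \<noteq> 0" "r \<noteq> 0" using ne r by auto
  have cf: "x * cj (f x) = f x" "x * cj (h x) = h x" if "x \<in> circ" for x
    using that by (simp_all add: f_def h_def circ_iff algebra_simps)
  have A: "?A x = s * (fr (f x) * f x) + t * (fr (h x) * h x)" for x
    using val_two_term[OF form[unfolded split_form_def]] by (simp only: f_def h_def)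
  have B: "?B x = cj s * (fr (f x) * f x) + cj t * (fr (h x) * h x)" if "x \<in> circ" for x
  proof -
    have "?B x = cj s * (fr (x * cj (f x)) * (x * cj (f x))) + cj t * (fr (x * cj (h x)) * (x * cj (h x)))"
      unfolding val_cj[OF that] A by (simp add: algebra_simps)
    then show ?thesis unfolding cf[OF that] .
  qed
  \<comment> \<open>Away from both roots \<open>f y / h y\<close> is finite and nonzero, so
    \<open>x = y\<close> will force \<open>r = 1\<close>.\<close>
  obtain y where y: "y \<in> circ" "y \<notin> {- cj v / v, - cj w / w}"
    using ex_circ_avoiding[of "{- cj v / v, - cj w / w}"] card_insert_le_m1[of 2 "{- cj w / w}"] by auto
  have fy: "f y \<noteq> 0" and hy: "h y \<noteq> 0"
    using y(2) vw by (auto simp: f_def h_def field_simps add_eq_0_iff)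
  have nz: "f x \<noteq> 0 \<or> h x \<noteq> 0" for x
  proof (rule ccontr)
    assume "\<not> ?thesis"
    then have "cj v = - v * x" "cj w = - w * x" by (simp_all add: f_def h_def add_eq_0_iff)
    then show False using ne by simp
  qed
  \<comment> \<open>\<open>f x * h y = r * (f y * h x)\<close> is linear in \<open>x\<close> and
    reads \<open>x * M + y * cj M = 0\<close>, whose solution lies in \<open>circ\<close> once
    \<open>M\<close> is nonzero.\<close>
  define M where "M = v * h y - r * w * f y"
  have yM: "y * cj M = cj v * h y - r * cj w * f y"
  proof -
    have "y * cj M = cj v * (y * cj (h y)) - cj r * cj w * (y * cj (f y))"
      by (simp add: M_def algebra_simps)
    then show ?thesis unfolding cf[OF y(1)] r .
  qed
  have M: "M \<noteq> 0"
  proof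
    assume M0: "M = 0"
    then have "cj v * M - v * (y * cj M) = 0" by simp
    also have "cj v * M - v * (y * cj M) = r * f y * (v * cj w - cj v * w)"
      unfolding yM by (simp add: M_def algebra_simps)
    finally show False using fy vw ne by simp
  qed
  define x where "x = - (y * (cj M / M))"
  have x: "x \<in> circ" unfolding x_def by (intro circ_closed cj_over_circ M y(1))
  have rel: "f x * h y = r * (f y * h x)"
  proof -
    have "x * M = - (y * cj M)" using M by (simp add: x_def)
    then have "x * M + (cj v * h y - r * cj w * f y) = 0" by (simp add: yM)
    then show ?thesis by (simp add: M_def f_def[of x] h_def[of x] algebra_simps)
  qed
  have key: "(fr (f x) * f x) * (fr (h y) * h y) = (fr (f y) * f y) * (fr (h x) * h x)"
  proof -
    have "(fr (f x) * f x) * (fr (h y) * h y) = fr (f x * h y) * (f x * h y)" by simp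
    also have "\<dots> = (fr r * r) * ((fr (f y) * f y) * (fr (h x) * h x))" unfolding rel by simp
    finally show ?thesis using r by simp
  qed
  have "?B x * ?A y - ?B y * ?A x = (cj s * t - s * cj t) *
      ((fr (f x) * f x) * (fr (h y) * h y) - (fr (f y) * f y) * (fr (h x) * h x))"
    unfolding B[OF x] B[OF y(1)] A by (simp add: algebra_simps)
  also have "\<dots> = 0" unfolding key by simp
  finally have "x = y" using permutes_inj[OF perm x y(1)] by simp
  then show ?thesis using rel fy hy by simp
qed

text \<open>\<open>f / h\<close> is a bijection of \<open>circ\<close>, and \<open>B / A\<close>
  depends only on its power with exponent \<open>Q + 1\<close> or \<open>Q - 1\<close>. The points
  where \<open>f / h\<close> is 1 and \<open>r\<close> thus share a value.\<close>

lemma nonsplit_ratio_trivial: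
  assumes perm: "permutes a b c d" and ne: "v * cj v \<noteq> w * cj w" and r: "r \<in> circ"
    and form: "diag_form s t v w a b c d \<and> fr r * r = 1 \<or> anti_form s t v w a b c d \<and> fr r = r"
  shows "r = 1"
proof -
  let ?B = "val (cj d) (cj c) (cj b) (cj a)" and ?A = "val a b c d"
  define f where "f x = v * x + w" for x
  define h where "h x = cj w * x + cj v" for x
  have nz: "f x \<noteq> 0" "h x \<noteq> 0" if "x \<in> circ" for x
    using mobius_bij(2,3)[OF ne that] by (simp_all add: f_def h_def)
  have cf: "x * cj (f x) = h x" "x * cj (h x) = f x" if "x \<in> circ" for x
    using that by (simp_all add: f_def h_def circ_iff algebra_simps)
  have "(\<lambda>x. f x / h x) ` circ = circ" using mobius_bij(1)[OF ne] by (simp add: bij_betw_def f_def h_def)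
  then obtain x y where xy: "x \<in> circ" "y \<in> circ" "f x / h x = 1" "f y / h y = r"
    using r circ_closed(6) by (metis (no_types, lifting) imageE)
  then have fh: "f x = h x" "f y = r * h y" using nz by (auto simp: field_simps)
  have "?B x * ?A y = ?B y * ?A x"
    using form
  proof
    assume *: "diag_form s t v w a b c d \<and> fr r * r = 1"
    have A: "?A x = s * (fr (f x) * f x) + t * (fr (h x) * h x)" for x
      using val_two_term[of a b c d s v w v w t] * by (simp only: f_def h_def diag_form_def)
    have B: "?B x = cj s * (fr (h x) * h x) + cj t * (fr (f x) * f x)" if "x \<in> circ" for x
    proof -
      have "?B x = cj s * (fr (x * cj (f x)) * (x * cj (f x))) + cj t * (fr (x * cj (h x)) * (x * cj (h x)))"
        unfolding val_cj[OF that] A by (simp add: algebra_simps)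
      then show ?thesis unfolding cf[OF that] .
    qed
    have "fr (r * h y) * (r * h y) = (fr r * r) * (fr (h y) * h y)" by simp
    then have ff: "fr (f y) * f y = fr (h y) * h y" "fr (f x) * f x = fr (h x) * h x" using * fh by simp_all
    show ?thesis unfolding A B[OF xy(1)] B[OF xy(2)] ff by (simp add: algebra_simps)
  next
    assume *: "anti_form s t v w a b c d \<and> fr r = r"
    have A: "?A x = s * (fr (f x) * h x) + t * (fr (h x) * f x)" for x
      using val_two_term[of a b c d s v w "cj w" "cj v" t] * by (simp only: f_def h_def anti_form_def)
    have B: "?B x = cj s * (fr (h x) * f x) + cj t * (fr (f x) * h x)" if "x \<in> circ" for x
    proof -
      have "?B x = cj s * (fr (x * cj (f x)) * (x * cj (h x))) + cj t * (fr (x * cj (h x)) * (x * cj (f x)))"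
        unfolding val_cj[OF that] A by (simp add: algebra_simps)
      then show ?thesis unfolding cf[OF that] .
    qed
    show ?thesis unfolding A B[OF xy(1)] B[OF xy(2)] fh using * by (simp add: algebra_simps)
  qed
  then have "x = y" using permutes_inj[OF perm xy(1,2)] by blast
  then show ?thesis using xy nz by auto
qed

section \<open>Exclusion of odd characteristic and translation to polynomials\<close>

lemma poly_quadrinomial: "poly (quadrinomial Q a b c d) x = val a b c d x"
  by (simp add: quadrinomial_def val_def poly_monom fr_def mult_ac)

text \<open>\<open>-1\<close> is fixed by \<open>cj\<close> and \<open>fr\<close> and lies in
  \<open>circ\<close>, so it qualifies as the ratio \<open>r\<close> in every form.\<close>

lemma permutes_imp_char_2:
  assumes perm: "permutes a b c d"
  shows "p = 2"
proof -
  have "(- 1 :: 'a) = 1"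
  proof (cases "\<exists>u\<in>circ. det_poly a b c d u = 0")
    case True
    then obtain s t v w where "v * cj w \<noteq> cj v * w" "split_form s t v w a b c d"
      using split_forms(2)[OF perm] by blast
    then show ?thesis using split_ratio_trivial[OF perm, of s t v w "-1"] by simp
  next
    case False
    then obtain u where "u \<notin> circ" "det_poly a b c d u = 0" using ex_det_root by blast
    then obtain s t v w where "v * cj v \<noteq> w * cj w" "diag_form s t v w a b c d \<or> anti_form s t v w a b c d"
      using nonsplit_forms[OF perm] by blast
    then show ?thesis using nonsplit_ratio_trivial[OF perm, of v w "-1" s t] by (auto simp: circ_iff)
  qed
  then have "of_nat 2 = (0::'a)" by (metis add.right_inverse numeral_One of_nat_numeral one_add_one)
  then have "p dvd 2" unfolding of_nat_eq_0_iff_char_dvd CHAR_eq .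
  then show ?thesis using p by (simp add: primes_dvd_imp_eq)
qed

definition rescaled where
  "rescaled e g a b c d a' b' c' d' \<longleftrightarrow> a' = e * (a * (fr g * g)) \<and> b' = e * (b * fr g) \<and> c' = e * (c * g) \<and> d' = e * d"

lemma quadrinomial_rescaled_iff:
  "quadrinomial Q a' b' c' d' = smult e (pcompose (quadrinomial Q a b c d) [:0, g:]) \<longleftrightarrow>
    rescaled e g a b c d a' b' c' d'"
  unfolding smult_pcompose_quadrinomial rescaled_def quadrinomial_eq_iff[OF Q_ge_2] fr_def ..

lemma exponents:
  "x ^ (Q + 1) = fr x * x" "x ^ (q + Q) = cj x * fr x" "x ^ (q * Q + 1) = fr (cj x) * x"
  "x ^ (q * Q + q) = fr (cj x) * cj x" "x ^ (q * Q) = fr (cj x)" "x ^ q = cj x" "x ^ Q = fr x" "x ^ (q + 1) = x * cj x"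
  unfolding cj_def fr_def power_add power_mult power_one_right by (simp_all only: mult.commute)

lemma permutes_iff:
  "permutes a b c d \<longleftrightarrow>
    (\<forall>x \<in> mu (q + 1). poly (quadrinomial Q a b c d) x \<noteq> 0) \<and>
    bij_betw (\<lambda>x. poly (quadrinomial Q (d ^ q) (c ^ q) (b ^ q) (a ^ q)) x / poly (quadrinomial Q a b c d) x)
      (mu (q + 1)) (mu (q + 1))"
  unfolding permutes_def poly_quadrinomial mu_eq cj_def ..

end

section \<open>Characteristic two\<close>

locale quadratic_ext_2 = quadratic_ext +
  assumes p2: "p = 2"
begin

lemma two_eq_0 [simp]: "(2::'a) = 0"
proof -
  have "of_nat p = (0::'a)" by (metis CHAR_eq of_nat_CHAR)
  then show ?thesis unfolding p2 by simp
qed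

lemma add_self [simp]: "x + x = (0::'a)" by (metis mult_2 mult_zero_left two_eq_0)
lemma add_self_left [simp]: "x + (x + y) = (y::'a)" by (simp flip: add.assoc)
lemma minus_eq: "- x = (x::'a)" by (metis add_self add_eq_0_iff)
lemma diff_eq: "x - y = x + (y::'a)" by (metis minus_eq diff_conv_add_uminus)

lemma add_eq_0_iff2: "x + y = 0 \<longleftrightarrow> x = (y::'a)"
  by (metis add_eq_0_iff minus_eq)

lemma square_eq_1: "x * x = 1 \<Longrightarrow> x = (1::'a)"
proof -
  assume "x * x = 1"
  then have "(x + 1) * (x + 1) = 0" by (simp add: algebra_simps)
  then show ?thesis by (simp add: add_eq_0_iff2)
qed

lemma of_nat_eq: "of_nat n = (if even n then 0 else 1 :: 'a)"
proof (cases "even n")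
  case True then show ?thesis by (auto elim!: evenE)
next
  case False then show ?thesis by (auto elim!: oddE)
qed

section \<open>Frobenius periods and the conditions on 2-adic valuations\<close>

lemma q2: "q = 2 ^ k" and Q2: "Q = 2 ^ l"
  unfolding q_def Q_def p2 by (rule refl)+

lemma cj_eq: "cj r = r ^ (2 ^ k)" and fr_eq: "fr r = r ^ (2 ^ l)"
  by (simp_all only: cj_def fr_def flip: q2 Q2)

lemma cj_fixed: "r ^ (2 ^ n) = r \<Longrightarrow> n dvd k \<Longrightarrow> cj r = r"
  unfolding cj_eq by (metis dvdE frobenius_periodic)

lemma fr_fixed: "r ^ (2 ^ n) = r \<Longrightarrow> n dvd l \<Longrightarrow> fr r = r"
  unfolding fr_eq by (metis dvdE frobenius_periodic)

lemma odd_k_div_gcd: "odd (k div gcd k l) \<longleftrightarrow> multiplicity 2 k \<le> multiplicity 2 l"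
  and odd_l_div_gcd: "odd (l div gcd k l) \<longleftrightarrow> multiplicity 2 l \<le> multiplicity 2 k"
  using odd_div_iff_multiplicity[OF gcd_dvd1 k, of l] odd_div_iff_multiplicity[OF gcd_dvd2 l, of k]
  unfolding multiplicity2_gcd_lcm(1)[OF k l] by linarith+

lemma gcd_double_right: "odd (k div gcd k l) \<Longrightarrow> gcd k (2 * l) dvd l"
proof -
  assume odd: "odd (k div gcd k l)"
  let ?g = "gcd k l"
  have kl: "k = ?g * (k div ?g)" "l = ?g * (l div ?g)" by simp_all
  have "coprime (k div ?g) (l div ?g)" using k by (intro div_gcd_coprime) auto
  then have "coprime (k div ?g) (2 * (l div ?g))" using odd by simp
  then have "gcd (?g * (k div ?g)) (?g * (2 * (l div ?g))) = ?g"
    by (simp only: gcd_mult_distrib_nat[symmetric]) simp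
  moreover have "?g * (2 * (l div ?g)) = 2 * l" using kl(2) by (metis mult.left_commute)
  ultimately show ?thesis using kl(1) by (metis gcd_dvd2)
qed

lemma gcd_double_left: "odd (l div gcd k l) \<Longrightarrow> gcd (2 * k) l dvd k"
proof -
  assume odd: "odd (l div gcd k l)"
  let ?g = "gcd k l"
  have kl: "k = ?g * (k div ?g)" "l = ?g * (l div ?g)" by simp_all
  have "coprime (k div ?g) (l div ?g)" using k by (intro div_gcd_coprime) auto
  then have "coprime (2 * (k div ?g)) (l div ?g)" using odd by simp
  then have "gcd (?g * (2 * (k div ?g))) (?g * (l div ?g)) = ?g"
    by (simp only: gcd_mult_distrib_nat[symmetric]) simp
  moreover have "?g * (2 * (k div ?g)) = 2 * k" using kl(1) by (metis mult.left_commute)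
  ultimately show ?thesis using kl(2) by (metis gcd_dvd1)
qed

lemma double_gcd_dvd: "even (n div gcd k l) \<Longrightarrow> gcd k l dvd n \<Longrightarrow> 2 * gcd k l dvd n"
proof -
  assume "even (n div gcd k l)" "gcd k l dvd n"
  then obtain c where "n div gcd k l = 2 * c" by (metis dvdE)
  moreover have "n = gcd k l * (n div gcd k l)" using \<open>gcd k l dvd n\<close> by (simp only: dvd_mult_div_cancel)
  ultimately have "n = 2 * gcd k l * c" by (metis mult.assoc mult.commute)
  then show ?thesis by (rule dvdI)
qed

lemma inv_iff: "x * y = 1 \<Longrightarrow> y = inverse (x::'a)"
  by (metis inverse_unique)

lemma cj_twice: "r ^ (2 ^ (2 * k)) = (r::'a)"
  using cj_cj[of r] unfolding cj_eq by (simp only: mult_2 power_add power_mult)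

lemma fr_twice: "fr r * r = 1 \<Longrightarrow> r ^ (2 ^ (2 * l)) = r"
proof -
  assume "fr r * r = 1"
  then have "fr r = inverse r" by (metis inv_iff mult.commute)
  then have "fr (fr r) = r" by simp
  then show ?thesis unfolding fr_eq by (simp only: mult_2 power_add power_mult)
qed

text \<open>\<open>2 ^ gcd k l + 1\<close> divides \<open>q^2 - 1\<close>, with quotient
  \<open>s\<close>; some nonzero \<open>x\<close> has \<open>x ^ s \<noteq> 1\<close>, and
  \<open>x ^ s\<close> serves. It is the obstruction whenever a valuation condition fails.\<close>

lemma ex_ratio: "\<exists>r::'a. r \<noteq> 1 \<and> r ^ (2 ^ gcd k l) * r = 1"
proof -
  let ?g = "gcd k l"
  let ?N = "2 ^ ?g + 1 :: nat" and ?M = "q ^ 2 - 1"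
  have "?g * 2 dvd k * 2" by simp
  then obtain n where n: "k * 2 = ?g * 2 * n" by blast
  have q: "q ^ 2 = ((2 ^ ?g) ^ 2) ^ n" unfolding q2 power_mult[symmetric] n by simp
  have "int ?N dvd int ?M"
  proof -
    have "int ?N dvd (2 ^ ?g) ^ 2 - 1"
      by (rule dvdI[of _ _ "2 ^ ?g - 1"]) (simp add: power2_eq_square algebra_simps)
    also have "((2 ^ ?g) ^ 2 - 1 :: int) dvd ((2 ^ ?g) ^ 2) ^ n - 1 ^ n"
      by (simp add: power_diff_1_eq)
    also have "\<dots> = int ?M" unfolding q by (simp add: of_nat_diff)
    finally show ?thesis .
  qed
  then have "?N dvd ?M" by (simp only: int_dvd_int_iff)
  then obtain s where s: "?M = s * ?N" by (metis dvdE mult.commute)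
  have "1 < q ^ 2" using q_ge_2 by (intro one_less_power) auto
  then have M: "?M > 0" by simp
  then have s0: "s > 0" using s by (cases s) auto
  have "\<exists>x::'a. x \<noteq> 0 \<and> x ^ s \<noteq> 1"
  proof (rule ccontr)
    assume "\<not> ?thesis"
    then have "card (UNIV - {0::'a}) \<le> card {x::'a. x ^ s = 1}" by (intro card_mono) auto
    also have "\<dots> \<le> s" using s0 by (rule card_roots_power_le)
    finally have "?M \<le> s" using card_UNIV by (simp add: card_Diff_singleton)
    moreover have "s * 1 < s * ?N" using s0 by (intro mult_strict_left_mono) auto
    ultimately show False using s by simp
  qed
  then obtain x :: 'a where x: "x \<noteq> 0" "x ^ s \<noteq> 1" by blast
  have "x ^ ?M * x = x ^ (q ^ 2)" using q_ge_2 by (intro power_minus_mult zero_less_power) simp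
  also have "\<dots> = x" using finite_field_power_card_eq_same[of x] card_UNIV by simp
  finally have "x ^ ?M = 1" using x by simp
  then have "(x ^ s) ^ ?N = 1" unfolding s power_mult .
  then show ?thesis using x(2) by (intro exI[of _ "x ^ s"]) (simp add: mult.commute)
qed

lemma frobenius_alternating:
  assumes "r ^ (2 ^ g) * r = (1::'a)"
  shows "r ^ (2 ^ (g * n)) = (if even n then r else inverse r)"
proof (induction n)
  case (Suc n)
  have "r ^ (2 ^ (g * Suc n)) = (r ^ (2 ^ (g * n))) ^ (2 ^ g)"
    by (simp add: power_add power_mult[symmetric] mult.commute)
  moreover have "r ^ (2 ^ g) = inverse r" using assms by (metis inv_iff mult.commute)
  ultimately show ?case using Suc by (simp add: power_inverse)
qed simp

lemma cj_fr_ratio: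
  assumes "r ^ (2 ^ gcd k l) * r = (1::'a)"
  shows "cj r = (if even (k div gcd k l) then r else inverse r)"
    and "fr r = (if even (l div gcd k l) then r else inverse r)"
  using frobenius_alternating[OF assms, of "k div gcd k l"] frobenius_alternating[OF assms, of "l div gcd k l"]
  by (simp_all add: cj_eq fr_eq)

lemma fixed_ratio_trivial: "cj r = r \<Longrightarrow> r * cj r = 1 \<Longrightarrow> r = 1"
  "fr r = r \<Longrightarrow> fr r * r = 1 \<Longrightarrow> r = 1"
  by (metis square_eq_1)+

text \<open>The exponents \<open>k\<close> and \<open>2 * l\<close> are periods of \<open>r\<close>,
  hence so is their gcd. Under the valuation condition it divides \<open>l\<close>, so
  \<open>fr r = r\<close> and \<open>r * r = 1\<close>. Otherwise the element of
  \<open>ex_ratio\<close> is fixed by \<open>cj\<close> and inverted by \<open>fr\<close>.\<close>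

lemma split_ratio_iff:
  "(\<forall>r. cj r = r \<and> fr r * r = 1 \<longrightarrow> r = 1) \<longleftrightarrow> multiplicity 2 k \<le> multiplicity 2 l"
proof
  assume le: "multiplicity 2 k \<le> multiplicity 2 l"
  show "\<forall>r. cj r = r \<and> fr r * r = 1 \<longrightarrow> r = 1"
  proof (intro allI impI, elim conjE)
    fix r assume r: "cj r = r" "fr r * r = 1"
    have "r ^ (2 ^ gcd k (2 * l)) = r"
      using r(1) fr_twice[OF r(2)] by (intro frobenius_gcd) (simp_all add: cj_eq)
    then show "r = 1"
      using fr_fixed gcd_double_right odd_k_div_gcd le r(2) fixed_ratio_trivial by blast
  qed
next
  assume *: "\<forall>r. cj r = r \<and> fr r * r = 1 \<longrightarrow> r = 1"
  obtain r :: 'a where r: "r \<noteq> 1" "r ^ (2 ^ gcd k l) * r = 1" using ex_ratio by blast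
  then have "r \<noteq> 0" by auto
  show "multiplicity 2 k \<le> multiplicity 2 l"
  proof (rule ccontr)
    assume "\<not> ?thesis"
    then have "cj r = r" "fr r * r = 1"
      using cj_fr_ratio[OF r(2)] odd_k_div_gcd odd_l_div_gcd \<open>r \<noteq> 0\<close> by auto
    then show False using * r by blast
  qed
qed

text \<open>Both maps invert \<open>r\<close>, so \<open>2 * gcd k l\<close> is a period. Unequal
  valuations make it divide \<open>k\<close> or \<open>l\<close>, and one map then both fixes and
  inverts \<open>r\<close>.\<close>

lemma diag_ratio_iff:
  "(\<forall>r. r * cj r = 1 \<and> fr r * r = 1 \<longrightarrow> r = 1) \<longleftrightarrow> multiplicity 2 k \<noteq> multiplicity 2 l"
proof
  assume ne: "multiplicity 2 k \<noteq> multiplicity 2 l"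
  show "\<forall>r. r * cj r = 1 \<and> fr r * r = 1 \<longrightarrow> r = 1"
  proof (intro allI impI, elim conjE)
    fix r assume r: "r * cj r = 1" "fr r * r = 1"
    have "r ^ (2 ^ gcd (2 * k) (2 * l)) = r"
      using cj_twice fr_twice[OF r(2)] by (rule frobenius_gcd)
    then have g: "r ^ (2 ^ (2 * gcd k l)) = r" by (simp add: gcd_mult_distrib_nat)
    have "even (k div gcd k l) \<or> even (l div gcd k l)"
      using ne odd_k_div_gcd odd_l_div_gcd by auto
    then have "cj r = r \<or> fr r = r"
      using double_gcd_dvd cj_fixed[OF g] fr_fixed[OF g] by auto
    then show "r = 1" using fixed_ratio_trivial r by blast
  qed
next
  assume *: "\<forall>r. r * cj r = 1 \<and> fr r * r = 1 \<longrightarrow> r = 1"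
  obtain r :: 'a where r: "r \<noteq> 1" "r ^ (2 ^ gcd k l) * r = 1" using ex_ratio by blast
  then have "r \<noteq> 0" by auto
  show "multiplicity 2 k \<noteq> multiplicity 2 l"
  proof
    assume "multiplicity 2 k = multiplicity 2 l"
    then have "r * cj r = 1" "fr r * r = 1"
      using cj_fr_ratio[OF r(2)] odd_k_div_gcd odd_l_div_gcd \<open>r \<noteq> 0\<close> by auto
    then show False using * r by blast
  qed
qed

text \<open>Mirror image of \<open>split_ratio_iff\<close>: under the valuation condition the period
  \<open>gcd (2 * k) l\<close> divides \<open>k\<close>.\<close>

lemma anti_ratio_iff:
  "(\<forall>r. r * cj r = 1 \<and> fr r = r \<longrightarrow> r = 1) \<longleftrightarrow> multiplicity 2 l \<le> multiplicity 2 k"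
proof
  assume le: "multiplicity 2 l \<le> multiplicity 2 k"
  show "\<forall>r. r * cj r = 1 \<and> fr r = r \<longrightarrow> r = 1"
  proof (intro allI impI, elim conjE)
    fix r assume r: "r * cj r = 1" "fr r = r"
    have "r ^ (2 ^ gcd (2 * k) l) = r"
      using r(2) cj_twice by (intro frobenius_gcd) (simp_all add: fr_eq)
    then show "r = 1"
      using cj_fixed gcd_double_left odd_l_div_gcd le r(1) fixed_ratio_trivial by blast
  qed
next
  assume *: "\<forall>r. r * cj r = 1 \<and> fr r = r \<longrightarrow> r = 1"
  obtain r :: 'a where r: "r \<noteq> 1" "r ^ (2 ^ gcd k l) * r = 1" using ex_ratio by blast
  then have "r \<noteq> 0" by auto
  show "multiplicity 2 l \<le> multiplicity 2 k"
  proof (rule ccontr)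
    assume "\<not> ?thesis"
    then have "r * cj r = 1" "fr r = r"
      using cj_fr_ratio[OF r(2)] odd_k_div_gcd odd_l_div_gcd \<open>r \<noteq> 0\<close> by auto
    then show False using * r by blast
  qed
qed

section \<open>The trace condition\<close>

definition pow2_gcd :: nat where "pow2_gcd = max_pow2_dvd (gcd k l)"

lemma pow2_gcd_eq: "pow2_gcd = 2 ^ min (multiplicity 2 k) (multiplicity 2 l)"
proof -
  have "gcd k l > 0" using k by simp
  then show ?thesis unfolding pow2_gcd_def by (simp only: max_pow2_dvd_eq multiplicity2_gcd_lcm(1)[OF k l])
qed

lemma pow2_gcd_dvd: "pow2_gcd dvd k" "pow2_gcd dvd l"
proof -
  have "gcd k l > 0" using k by simp
  then have "pow2_gcd dvd gcd k l" unfolding pow2_gcd_def by (simp only: max_pow2_dvd_eq multiplicity_dvd)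
  then show "pow2_gcd dvd k" "pow2_gcd dvd l" by auto
qed

lemma odd_div_pow2_gcd:
  "odd (k div pow2_gcd) \<longleftrightarrow> multiplicity 2 k \<le> multiplicity 2 l"
  "odd (l div pow2_gcd) \<longleftrightarrow> multiplicity 2 l \<le> multiplicity 2 k"
  "odd (lcm k l div pow2_gcd) \<longleftrightarrow> multiplicity 2 k = multiplicity 2 l"
proof -
  have m: "multiplicity 2 pow2_gcd = min (multiplicity 2 k) (multiplicity 2 l)"
    by (simp add: pow2_gcd_eq)
  show "odd (k div pow2_gcd) \<longleftrightarrow> multiplicity 2 k \<le> multiplicity 2 l"
    using odd_div_iff_multiplicity[OF pow2_gcd_dvd(1) k] m by auto
  show "odd (l div pow2_gcd) \<longleftrightarrow> multiplicity 2 l \<le> multiplicity 2 k"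
    using odd_div_iff_multiplicity[OF pow2_gcd_dvd(2) l] m by auto
  have "pow2_gcd dvd lcm k l" using pow2_gcd_dvd by (meson dvd_lcm1 dvd_trans)
  moreover have "lcm k l > 0" using k l by (simp add: lcm_pos_nat)
  ultimately have "odd (lcm k l div pow2_gcd) \<longleftrightarrow> multiplicity 2 (lcm k l) = multiplicity 2 pow2_gcd"
    by (rule odd_div_iff_multiplicity)
  then show "odd (lcm k l div pow2_gcd) \<longleftrightarrow> multiplicity 2 k = multiplicity 2 l"
    using m multiplicity2_gcd_lcm(2)[OF k l] by auto
qed

text \<open>\<open>cj\<close> and \<open>fr\<close> are iterates of the \<open>2 ^ pow2_gcd\<close>
  power map. Shifting the sum \<open>S\<close> of \<open>n\<close> consecutive iterates of
  \<open>z\<close> by one changes it by \<open>cj z + z = h\<close>, so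
  \<open>S 0 + S (l div pow2_gcd)\<close> collapses to a multiple of \<open>h\<close>.\<close>

lemma trace_eq:
  assumes z: "cj z = z + h" and h: "h = 0 \<or> h = 1" and eps: "eps = 0 \<or> eps = 1"
  shows "ff_trace (2 ^ pow2_gcd) (k div pow2_gcd) (z + fr z + eps) = h * of_nat (l div pow2_gcd) + eps * of_nat (k div pow2_gcd)"
proof -
  define r :: nat where "r = 2 ^ pow2_gcd"
  define ph where "ph i x = x ^ (r ^ i)" for i and x :: 'a
  define n where "n = k div pow2_gcd"
  have ph: "ph i x = x ^ (2 ^ (pow2_gcd * i))" for i x by (simp add: ph_def r_def power_mult)
  have ph_add: "ph i (x + y) = ph i x + ph i y" for i x y
    unfolding ph using freshmans_dream'[where ?'a='a, of "2 ^ (pow2_gcd * i)" "pow2_gcd * i" x y] CHAR_eq p2 by simp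
  have ph_ph: "ph i (ph j x) = ph (i + j) x" for i j x
    by (simp add: ph_def power_add power_mult[symmetric] mult.commute)
  have ph01: "ph i x = x" if "x = 0 \<or> x = 1" for i x
    using that by (auto simp: ph)
  have cj_ph: "cj x = ph n x" for x unfolding ph n_def cj_eq using pow2_gcd_dvd by simp
  have fr_ph: "fr x = ph (l div pow2_gcd) x" for x unfolding ph fr_eq using pow2_gcd_dvd by simp
  define S where "S j = (\<Sum>i<n. ph (i + j) z)" for j
  have step: "S (Suc j) = S j + h" for j
  proof -
    have "S (Suc j) + ph j z = (\<Sum>i<Suc n. ph (i + j) z)"
      unfolding S_def by (subst sum.lessThan_Suc_shift) (simp add: add.commute)
    also have "\<dots> = S j + ph j (ph n z)" by (simp add: S_def ph_ph add.commute)
    also have "ph j (ph n z) = ph j z + h" unfolding cj_ph[symmetric] z by (simp add: ph_add ph01[OF h])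
    finally show ?thesis by (simp add: add.left_commute add.assoc[symmetric])
  qed
  have S: "S j = S 0 + h * of_nat j" for j
    by (induction j) (simp_all add: step algebra_simps)
  have "ff_trace r n (z + fr z + eps) = (\<Sum>i<n. ph i z + ph (i + l div pow2_gcd) z + eps)"
    unfolding ff_trace_def ph_def[symmetric] fr_ph ph_add ph_ph by (simp add: ph01[OF eps])
  also have "\<dots> = S 0 + S (l div pow2_gcd) + of_nat n * eps"
    by (simp add: S_def sum.distrib)
  also have "\<dots> = h * of_nat (l div pow2_gcd) + eps * of_nat n"
    unfolding S[of "l div pow2_gcd"] by (simp add: mult.commute)
  finally show ?thesis by (simp add: r_def n_def)
qed

text \<open>Only parities matter. The quotients of \<open>k\<close> and \<open>l\<close> by
  \<open>pow2_gcd\<close> are never both even, and that of the lcm is odd exactly when both are odd;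
  this rules out \<open>h = eps = 1\<close>.\<close>

lemma trace_cond_iff:
  assumes z: "cj z = z + h" and h: "h = 0 \<or> h = 1" and eps: "eps = 0 \<or> eps = 1"
  shows "ff_trace (2 ^ pow2_gcd) (k div pow2_gcd) (z + fr z + eps) = of_nat (lcm k l div pow2_gcd) \<longleftrightarrow>
    (h = 1 \<and> eps = 0 \<and> multiplicity 2 k \<le> multiplicity 2 l \<or>
     h = 0 \<and> eps = 0 \<and> multiplicity 2 k \<noteq> multiplicity 2 l \<or>
     h = 0 \<and> eps = 1 \<and> multiplicity 2 l \<le> multiplicity 2 k)"
proof -
  have even: "even (k div pow2_gcd) \<longleftrightarrow> multiplicity 2 l < multiplicity 2 k"
    "even (l div pow2_gcd) \<longleftrightarrow> multiplicity 2 k < multiplicity 2 l"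
    "even (lcm k l div pow2_gcd) \<longleftrightarrow> multiplicity 2 k \<noteq> multiplicity 2 l"
    using odd_div_pow2_gcd by (metis not_le)+
  show ?thesis unfolding trace_eq[OF assms] of_nat_eq even using h eps by (elim disjE) auto
qed

section \<open>Invariants of the coefficients\<close>

text \<open>\<open>nrm\<close> is the \<open>e\<close> of the theorem, \<open>inv1\<close> and
  \<open>inv2\<close> are the bracketed sums in its power equation, and \<open>num\<close> is the
  numerator under the trace.\<close>

definition nrm where "nrm a b c d = a * cj a + b * cj b + c * cj c + d * cj d"
definition inv1 where "inv1 a b c d = a * cj b + c * cj d"
definition inv2 where "inv2 a b c d = a * cj c + b * cj d"
definition num where "num b c = b * cj b + c * cj c"

text \<open>The classifying parameters: \<open>h = 0\<close> iff \<open>z\<close> lies in the field with \<open>q\<close> elements, and \<open>eps = 0\<close> iff the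
  two terms of \<open>A\<close> pair each linear factor with itself.\<close>

definition invs where
  "invs z h eps a b c d \<longleftrightarrow> nrm a b c d * fr (inv1 a b c d) = fr (nrm a b c d) * inv2 a b c d \<and>
     num b c = nrm a b c d * (z + fr z + eps) \<and> cj z = z + h"

lemma two_termD:
  assumes "two_term a b c d s f1 f2 g1 g2 t h1 h2 k1 k2"
  shows "a = s * (fr f1 * g1) + t * (fr h1 * k1)" "b = s * (fr f1 * g2) + t * (fr h1 * k2)"
     "c = s * (fr f2 * g1) + t * (fr h2 * k1)" "d = s * (fr f2 * g2) + t * (fr h2 * k2)"
  using assms by (simp_all only: two_term_def)

text \<open>\<open>nrm\<close> factors into a determinant in \<open>s\<close>, \<open>t\<close>
  times the \<open>(Q + 1)\<close>-st power of one in \<open>v\<close>, \<open>w\<close>, so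
  \<open>nrm \<noteq> 0\<close> expresses nondegeneracy.\<close>

lemma split_form_inv:
  assumes "split_form s t v w a b c d"
  defines "e \<equiv> s * cj t + cj s * t" and "u \<equiv> v * cj w + cj v * w"
  shows "nrm a b c d = e * (fr u * u)" "inv1 a b c d = e * (fr u * (v * w))"
    "inv2 a b c d = e * (u * fr (v * w))" "num b c = e * (v * cj w * fr u + fr (v * cj w) * u)"
  unfolding nrm_def inv1_def inv2_def num_def e_def u_def two_termD[OF assms(1)[unfolded split_form_def]]
  by (simp_all add: algebra_simps)

lemma diag_form_inv:
  assumes "diag_form s t v w a b c d"
  defines "e \<equiv> s * cj s + t * cj t" and "u \<equiv> v * cj v + w * cj w"
  shows "nrm a b c d = e * (fr u * u)" "inv1 a b c d = e * (fr u * (v * cj w))"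
    "inv2 a b c d = e * (u * fr (v * cj w))" "num b c = e * (w * cj w * fr u + fr (w * cj w) * u)"
  unfolding nrm_def inv1_def inv2_def num_def e_def u_def two_termD[OF assms(1)[unfolded diag_form_def]]
  by (simp_all add: algebra_simps)

lemma anti_form_inv:
  assumes "anti_form s t v w a b c d"
  defines "e \<equiv> s * cj s + t * cj t" and "u \<equiv> v * cj v + w * cj w"
  shows "nrm a b c d = e * (fr u * u)" "inv1 a b c d = e * (fr u * (v * cj w))"
    "inv2 a b c d = e * (u * fr (v * cj w))" "num b c = e * (w * cj w * fr u + fr (w * cj w) * u + fr u * u)"
  unfolding nrm_def inv1_def inv2_def num_def e_def u_def two_termD[OF assms(1)[unfolded anti_form_def]]
  by (simp_all add: algebra_simps)

text \<open>\<open>z = v * cj w / u\<close> has trace 1, since \<open>u\<close> is self-conjugate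
  and is the trace of \<open>v * cj w\<close>.\<close>

lemma split_form_invs:
  assumes "split_form s t v w a b c d" "nrm a b c d \<noteq> 0"
  shows "\<exists>z. invs z 1 0 a b c d"
proof -
  note i = split_form_inv[OF assms(1)]
  define e where "e = s * cj t + cj s * t"
  define u where "u = v * cj w + cj v * w"
  note i = i[folded e_def u_def]
  have nz: "u \<noteq> 0" using assms(2) i(1) by auto
  have cu: "cj u = u" by (simp add: u_def algebra_simps)
  have "cj (v * cj w / u) = v * cj w / u + 1"
  proof -
    have "cj (v * cj w / u) = (v * cj w + u) / u" by (simp add: cu) (simp add: u_def)
    then show ?thesis using nz by (simp add: add_divide_distrib)
  qed
  moreover have "num b c = nrm a b c d * (v * cj w / u + fr (v * cj w / u) + 0)"
    unfolding i using nz by (simp add: field_simps)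
  moreover have "nrm a b c d * fr (inv1 a b c d) = fr (nrm a b c d) * inv2 a b c d"
    unfolding i by (simp add: algebra_simps)
  ultimately show ?thesis unfolding invs_def by blast
qed

text \<open>\<open>z = w * cj w / u\<close> is self-conjugate; the extra \<open>fr u * u\<close> in
  \<open>num\<close> for \<open>anti_form\<close> accounts for \<open>eps = 1\<close>.\<close>

lemma nonsplit_form_invs:
  assumes "diag_form s t v w a b c d \<and> eps = 0 \<or> anti_form s t v w a b c d \<and> eps = 1" "nrm a b c d \<noteq> 0"
  shows "\<exists>z. invs z 0 eps a b c d"
proof -
  define e where "e = s * cj s + t * cj t"
  define u where "u = v * cj v + w * cj w"
  have i: "nrm a b c d = e * (fr u * u)" "inv1 a b c d = e * (fr u * (v * cj w))"
    "inv2 a b c d = e * (u * fr (v * cj w))" "num b c = e * (w * cj w * fr u + fr (w * cj w) * u + eps * (fr u * u))"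
    using assms(1) diag_form_inv[of s t v w a b c d] anti_form_inv[of s t v w a b c d]
    by (auto simp: e_def u_def)
  have nz: "u \<noteq> 0" using assms(2) i(1) by auto
  have cu: "cj u = u" by (simp add: u_def algebra_simps)
  have "cj (w * cj w / u) = w * cj w / u + 0" by (simp add: cu mult.commute)
  moreover have "num b c = nrm a b c d * (w * cj w / u + fr (w * cj w / u) + eps)"
    unfolding i using nz by (simp add: field_simps)
  moreover have "nrm a b c d * fr (inv1 a b c d) = fr (nrm a b c d) * inv2 a b c d"
    unfolding i by (simp add: algebra_simps)
  ultimately show ?thesis unfolding invs_def by blast
qed

section \<open>Recovering the forms from the invariants\<close>

text \<open>The equations for \<open>a\<close> and \<open>b\<close> are linear in \<open>s\<close>,
  \<open>t\<close> and determine them; \<open>I1\<close> and \<open>I2\<close> make \<open>c\<close>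
  and \<open>d\<close> agree.\<close>

lemma two_root_expansion:
  assumes W: "W \<noteq> 0" and z: "z * z + z = W * cj W" and th: "th = z + fr z + eps"
    and eps: "eps = 0 \<or> eps = 1"
    and I1: "a * th = W * b + fr W * c" and I2: "a * cj W + (th + 1) * b = d * fr W"
  shows "\<exists>s t. two_term a b c d s W (z + eps) W z t W (z + 1 + eps) W (z + 1)"
proof -
  define t where "t = (b * W + a * z) / (fr W * W)"
  define s where "s = (a + b * W + a * z) / (fr W * W)"
  have st: "s * (fr W * W) = a + b * W + a * z" "t * (fr W * W) = b * W + a * z"
    using W by (simp_all add: s_def t_def)
  have eps2: "eps * eps = eps" "fr eps = eps" using eps by auto
  have "two_term a b c d s W (z + eps) W z t W (z + 1 + eps) W (z + 1)"
    unfolding two_term_def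
  proof (intro conjI)
    show "a = s * (fr W * W) + t * (fr W * W)" unfolding st by simp
    have "W * b = z * (s * (fr W * W)) + (z + 1) * (t * (fr W * W))"
      unfolding st by (simp add: algebra_simps)
    also have "\<dots> = W * (s * (fr W * z) + t * (fr W * (z + 1)))" by (simp add: algebra_simps)
    finally show "b = s * (fr W * z) + t * (fr W * (z + 1))" using W by simp
    have "fr W * c = a * th + W * b" unfolding I1 by simp
    also have "\<dots> = fr (z + eps) * (s * (fr W * W)) + fr (z + 1 + eps) * (t * (fr W * W))"
      unfolding st th using eps2 by (simp add: algebra_simps)
    also have "\<dots> = fr W * (s * (fr (z + eps) * W) + t * (fr (z + 1 + eps) * W))"
      by (simp add: algebra_simps del: fr_add)
    finally show "c = s * (fr (z + eps) * W) + t * (fr (z + 1 + eps) * W)" using W by simp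
    have "W * (fr W * d) = a * (z * z + z) + W * ((th + 1) * b)"
      unfolding z mult.commute[of "fr W"] I2[symmetric] by (simp add: algebra_simps)
    also have "\<dots> = fr (z + eps) * z * (s * (fr W * W)) + fr (z + 1 + eps) * (z + 1) * (t * (fr W * W))"
      unfolding st th using eps2 by (simp add: algebra_simps)
    also have "\<dots> = W * (fr W * (s * (fr (z + eps) * z) + t * (fr (z + 1 + eps) * (z + 1))))"
      by (simp add: algebra_simps del: fr_add)
    finally show "d = s * (fr (z + eps) * z) + t * (fr (z + 1 + eps) * (z + 1))" using W by simp
  qed
  then show ?thesis by blast
qed

text \<open>Hilbert 90 for \<open>y / W\<close>.\<close>

lemma split_vector:
  assumes "W \<noteq> 0" "y * cj y = W * cj W"
  shows "\<exists>v m. W = m * v \<and> y = m * cj v"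
proof -
  have "(y / W) * cj (y / W) = 1" using assms by simp
  then obtain v where v: "v \<noteq> 0" "cj v = (y / W) * v" using hilbert90 by blast
  then have "W = (W / v) * v \<and> y = (W / v) * cj v" using assms by simp
  then show ?thesis by blast
qed

lemma forms_of_invariants:
  assumes e: "nrm a b c d \<noteq> 0"
    and cond: "nrm a b c d * fr (inv1 a b c d) = fr (nrm a b c d) * inv2 a b c d"
  obtains z h eps where "h = 0 \<or> h = 1" "eps = 0 \<or> eps = 1" "invs z h eps a b c d"
    "h = 1 \<Longrightarrow> eps = 0 \<Longrightarrow> \<exists>s t v w. split_form s t v w a b c d"
    "h = 0 \<Longrightarrow> eps = 0 \<Longrightarrow> \<exists>s t v w. diag_form s t v w a b c d"
    "h = 0 \<Longrightarrow> eps = 1 \<Longrightarrow> \<exists>s t v w. anti_form s t v w a b c d"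
proof -
  define e where "e = nrm a b c d"
  have e0: "e \<noteq> 0" using e by (simp add: e_def)
  have ce: "cj e = e" by (simp add: e_def nrm_def algebra_simps)
  define th where "th = num b c / e"
  have num: "num b c = e * th" using e0 by (simp add: th_def)
  have oth: "a * cj a + d * cj d = e * (th + 1)"
  proof -
    have "e * (th + 1) = num b c + e" by (simp add: num algebra_simps)
    then show ?thesis by (simp add: num_def e_def nrm_def algebra_simps)
  qed
  define W where "W = inv1 a b c d / e"
  have w1: "inv1 a b c d = e * W" using e0 by (simp add: W_def)
  have w2: "inv2 a b c d = e * fr W"
    using cond e0 unfolding e_def[symmetric] w1 by simp
  \<comment> \<open>Dividing this identity by \<open>e * e\<close> gives \<open>tht\<close>, which
    later yields \<open>eps * (eps + 1) = 0\<close>.\<close>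
  have prod: "num b c * (a * cj a + d * cj d) = inv1 a b c d * cj (inv1 a b c d) + inv2 a b c d * cj (inv2 a b c d)"
    by (simp add: num_def inv1_def inv2_def algebra_simps)
  have tht: "th * (th + 1) = W * cj W + fr (W * cj W)"
  proof -
    have "(e * e) * (th * (th + 1)) = (e * e) * (W * cj W + fr (W * cj W))"
      using prod unfolding num oth w1 w2 by (simp add: ce algebra_simps)
    then show ?thesis using e0 by simp
  qed
  show ?thesis
  proof (cases "W = 0")
    case True
    then have "th = 0 \<or> th = 1" using tht by (simp add: add_eq_0_iff2)
    have z1: "a * cj b = c * cj d" and z2: "a * cj c = b * cj d"
      using w1 w2 True by (simp_all add: inv1_def inv2_def add_eq_0_iff2)
    \<comment> \<open>For \<open>W = 0\<close> the root \<open>z = 0\<close> serves and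
      \<open>th\<close> itself is \<open>eps\<close>; only \<open>a\<close> and \<open>d\<close>, or
      only \<open>b\<close> and \<open>c\<close>, survive.\<close>
    have inv: "invs 0 0 th a b c d" using cond num unfolding invs_def by (simp add: e_def)
    from \<open>th = 0 \<or> th = 1\<close> show ?thesis
    proof
      assume th: "th = 0"
      then have bc: "b * cj b = c * cj c" using num by (simp add: num_def add_eq_0_iff2)
      have "b = 0"
      proof (rule ccontr)
        assume "b \<noteq> 0"
        have "(b * cj b) * (a * cj a) = (c * cj d) * cj (c * cj d)" unfolding z1[symmetric] by (simp add: algebra_simps)
        also have "\<dots> = (b * cj b) * (d * cj d)" unfolding bc by (simp add: algebra_simps)
        finally have "a * cj a = d * cj d" using \<open>b \<noteq> 0\<close> by simp
        then show False using oth e0 th by simp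
      qed
      then have "c = 0" using bc by simp
      then have "diag_form a d 1 0 a b c d" using \<open>b = 0\<close> by (simp add: diag_form_def two_term_def)
      then show ?thesis using that[of 0 0 0] inv th by auto
    next
      assume th: "th = 1"
      then have ad: "a * cj a = d * cj d" using oth by (simp add: add_eq_0_iff2)
      have "a = 0"
      proof (rule ccontr)
        assume "a \<noteq> 0"
        have "(a * cj a) * (b * cj b) = (c * cj d) * cj (c * cj d)" unfolding z1[symmetric] by (simp add: algebra_simps)
        also have "\<dots> = (a * cj a) * (c * cj c)" unfolding ad by (simp add: algebra_simps)
        finally have "b * cj b = c * cj c" using \<open>a \<noteq> 0\<close> by simp
        then show False using num e0 th by (simp add: num_def)
      qed
      then have "d = 0" using ad by simp
      then have "anti_form b c 1 0 a b c d" using \<open>a = 0\<close> by (simp add: anti_form_def two_term_def)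
      then show ?thesis using that[of 0 1 0] inv th by auto
    qed
  next
    case False
    have "cj (1::'a) = 1" "cj (W * cj W) = W * cj W" by (simp_all add: mult.commute)
    then obtain z where "z ^ 2 + 1 * z + W * cj W = 0" using quadratic_root by blast
    then have z: "z * z + z = W * cj W" by (simp add: power2_eq_square add_eq_0_iff2)
    have z0: "z \<noteq> 0" "z + 1 \<noteq> 0" using z False by (auto simp: add_eq_0_iff2)
    define h where "h = cj z + z"
    have cz: "cj z = z + h" by (simp add: h_def algebra_simps)
    have "h * (h + 1) = cj (z * z + z) + (z * z + z)" by (simp add: h_def algebra_simps)
    also have "\<dots> = 0" unfolding z by (simp add: algebra_simps)
    finally have h: "h = 0 \<or> h = 1" by (simp add: add_eq_0_iff2)
    define eps where "eps = th + z + fr z"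
    have th: "th = z + fr z + eps" by (simp add: eps_def algebra_simps)
    have "eps * (eps + 1) = th * (th + 1) + (z * z + z) + fr (z * z + z)" by (simp add: eps_def algebra_simps)
    also have "\<dots> = 0" unfolding z tht by (simp add: algebra_simps)
    finally have eps: "eps = 0 \<or> eps = 1" by (simp add: add_eq_0_iff2)
    have inv: "invs z h eps a b c d"
      unfolding invs_def using cond cz num th by (simp add: e_def)
    have I1: "a * th = W * b + fr W * c"
    proof -
      have "a * num b c = inv1 a b c d * b + inv2 a b c d * c"
        by (simp add: num_def inv1_def inv2_def algebra_simps)
      then have "e * (a * th) = e * (W * b + fr W * c)" unfolding num w1 w2 by (simp add: algebra_simps)
      then show ?thesis using e0 by simp
    qed
    have I2: "a * cj W + (th + 1) * b = d * fr W"
    proof -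
      have "a * cj (inv1 a b c d) + (a * cj a + d * cj d) * b = d * inv2 a b c d"
        by (simp add: inv1_def inv2_def algebra_simps)
      then have "e * (a * cj W + (th + 1) * b) = e * (d * fr W)"
        unfolding oth w1 w2 by (simp add: ce algebra_simps)
      then show ?thesis using e0 by simp
    qed
    obtain s t where st: "two_term a b c d s W (z + eps) W z t W (z + 1 + eps) W (z + 1)"
      using two_root_expansion[OF False z th eps I1 I2] by blast
    show ?thesis
    proof (rule that[OF h eps inv])
      assume "h = 1" "eps = 0"
      \<comment> \<open>\<open>cj z = z + 1\<close>, so \<open>z * cj z = z * z + z\<close> is the
        norm of \<open>W\<close>, and both linear factors have their roots in
        \<open>circ\<close>.\<close>
      then have "z * cj z = W * cj W" "(z + 1) * cj (z + 1) = W * cj W"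
        using z cz by (simp_all add: algebra_simps)
      then obtain v m w n where vm: "W = m * v" "z = m * cj v" and wn: "W = n * w" "z + 1 = n * cj w"
        using split_vector[OF False] by metis
      have "two_term a b c d s (m * v) (m * cj v) (m * v) (m * cj v) t (n * w) (n * cj w) (n * w) (n * cj w)"
        using st \<open>eps = 0\<close> vm wn by simp
      then have "split_form (s * (fr m * m)) (t * (fr n * n)) v w a b c d"
        unfolding split_form_def two_term_def by (simp add: algebra_simps)
      then show "\<exists>s t v w. split_form s t v w a b c d" by blast
    next
      assume "h = 0" "eps = 0"
      then have "cj z = z" using cz by simp
      \<comment> \<open>For self-conjugate \<open>z\<close>, \<open>z * (z + 1) = W * cj W\<close>
        makes \<open>W * X + z + 1\<close> equal to \<open>n\<close> times the conjugate reciprocal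
        of \<open>W * X + z\<close>.\<close>
      define n where "n = W / z"
      have n: "W = n * cj z" "z + 1 = n * cj W" unfolding \<open>cj z = z\<close>
        using z z0 by (simp_all add: n_def field_simps)
      have "two_term a b c d s W z W z t (n * cj z) (n * cj W) (n * cj z) (n * cj W)"
        using st \<open>eps = 0\<close> n by simp
      then have "diag_form s (t * (fr n * n)) W z a b c d"
        unfolding diag_form_def two_term_def by (simp add: algebra_simps)
      then show "\<exists>s t v w. diag_form s t v w a b c d" by blast
    next
      assume "h = 0" "eps = 1"
      then have "cj z = z" using cz by simp
      define n where "n = W / z"
      have n: "W = n * cj z" "z + 1 = n * cj W" unfolding \<open>cj z = z\<close>
        using z z0 by (simp_all add: n_def field_simps)
      have "two_term a b c d s (n * cj z) (n * cj W) W z t W z (n * cj z) (n * cj W)"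
        using st \<open>eps = 1\<close> n by (simp add: algebra_simps)
      \<comment> \<open>For \<open>eps = 1\<close> it is the \<open>t\<close> term that has
        \<open>W * X + z\<close> under the Frobenius twist, so the terms change places.\<close>
      then have "anti_form (t * n) (s * fr n) W z a b c d"
        unfolding anti_form_def two_term_def by (simp add: algebra_simps)
      then show "\<exists>s t v w. anti_form s t v w a b c d" by blast
    qed
  qed
qed

section \<open>The forms yield permutations\<close>

text \<open>\<open>B / A\<close> is an invertible fractional linear function, by \<open>st\<close>,
  of \<open>(f / h) ^ (Q + 1)\<close>. If two points share a value, the quotient \<open>r\<close> of
  their \<open>f / h\<close> is self-conjugate with \<open>fr r * r = 1\<close>, so
  \<open>ratio\<close> applies.\<close>

lemma split_form_permutes:
  assumes form: "split_form s t v w a b c d" and e: "nrm a b c d \<noteq> 0"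
    and ratio: "\<And>r. cj r = r \<Longrightarrow> fr r * r = 1 \<Longrightarrow> r = 1"
  shows "permutes a b c d"
proof -
  let ?B = "val (cj d) (cj c) (cj b) (cj a)" and ?A = "val a b c d"
  have st: "s * cj t + cj s * t \<noteq> 0" and vw: "v * cj w + cj v * w \<noteq> 0"
    using e split_form_inv(1)[OF form] by auto
  define f where "f x = v * x + cj v" for x
  define h where "h x = w * x + cj w" for x
  have cf: "x * cj (f x) = f x" "x * cj (h x) = h x" if "x \<in> circ" for x
    using that by (simp_all add: f_def h_def circ_iff algebra_simps)
  have A: "?A x = s * (fr (f x) * f x) + t * (fr (h x) * h x)" for x
    using val_two_term[OF form[unfolded split_form_def]] by (simp only: f_def h_def)
  have B: "?B x = cj s * (fr (f x) * f x) + cj t * (fr (h x) * h x)" if "x \<in> circ" for x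
  proof -
    have "?B x = cj s * (fr (x * cj (f x)) * (x * cj (f x))) + cj t * (fr (x * cj (h x)) * (x * cj (h x)))"
      unfolding val_cj[OF that] A by (simp add: algebra_simps)
    then show ?thesis unfolding cf[OF that] .
  qed
  have nz: "f x \<noteq> 0 \<or> h x \<noteq> 0" for x
  proof (rule ccontr)
    assume "\<not> ?thesis"
    then have "cj v = v * x" "cj w = w * x" by (simp_all add: f_def h_def add_eq_0_iff2)
    then show False using vw by (simp add: algebra_simps)
  qed
  have real: "cj (f x * h y / (f y * h x)) = f x * h y / (f y * h x)" if "x \<in> circ" "y \<in> circ" for x y
  proof -
    have "f x * h y / (f y * h x) = (x * cj (f x)) * (y * cj (h y)) / ((y * cj (f y)) * (x * cj (h x)))"
      unfolding cf[OF that(1)] cf[OF that(2)] ..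
    also have "\<dots> = cj (f x * h y / (f y * h x))" using circ_nz that by (simp add: field_simps)
    finally show ?thesis by simp
  qed
  show ?thesis
  proof (rule permutesI)
    fix x assume x: "x \<in> circ"
    show "?A x \<noteq> 0"
    proof
      assume A0: "?A x = 0"
      have "?B x = fr x * x * cj (?A x)" by (rule val_cj[OF x])
      then have B0: "?B x = 0" using A0 by simp
      have "(s * cj t + cj s * t) * (fr (f x) * f x) = cj t * ?A x + t * ?B x"
        unfolding A B[OF x] by (simp add: algebra_simps)
      then have "f x = 0" using A0 B0 st by simp
      have "(s * cj t + cj s * t) * (fr (h x) * h x) = cj s * ?A x + s * ?B x"
        unfolding A B[OF x] by (simp add: algebra_simps)
      then have "h x = 0" using A0 B0 st by simp
      then show False using nz[of x] \<open>f x = 0\<close> by simp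
    qed
  next
    fix x y assume x: "x \<in> circ" and y: "y \<in> circ" and eq: "?B x * ?A y = ?B y * ?A x"
    have "(s * cj t + cj s * t) * (fr (f x * h y) * (f x * h y) + fr (f y * h x) * (f y * h x))
      = ?B x * ?A y + ?B y * ?A x"
      unfolding A B[OF x] B[OF y] by (simp add: algebra_simps)
    also have "\<dots> = 0" unfolding eq by simp
    finally have FH: "fr (f x * h y) * (f x * h y) = fr (f y * h x) * (f y * h x)"
      using st by (simp add: add_eq_0_iff2)
    have "f x * h y = f y * h x"
    \<comment> \<open>Zeros of \<open>f\<close> or \<open>h\<close> are treated apart because the
      ratio is undefined there.\<close>
    proof (cases "f y * h x = 0")
      case True
      then have "fr (f x * h y) * (f x * h y) = 0" using FH by simp
      then show ?thesis using True by (auto simp del: fr_mult)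
    next
      case False
      define r where "r = f x * h y / (f y * h x)"
      have "fr r * r = 1" using FH False by (simp add: r_def field_simps)
      then have "r = 1" using ratio real[OF x y] unfolding r_def by blast
      then show ?thesis using False by (simp add: r_def)
    qed
    moreover have "f x * h y + f y * h x = (v * cj w + cj v * w) * (x + y)"
      by (simp add: f_def h_def algebra_simps)
    ultimately show "x = y" using vw by (simp add: add_eq_0_iff2)
  qed
qed

text \<open>The argument of \<open>split_form_permutes\<close>, except that
  \<open>x * cj (f x) = h x\<close> places the ratio in \<open>circ\<close>.\<close>

lemma nonsplit_form_permutes:
  assumes form: "diag_form s t v w a b c d \<and> (\<forall>r. r * cj r = 1 \<and> fr r * r = 1 \<longrightarrow> r = 1) \<or>
      anti_form s t v w a b c d \<and> (\<forall>r. r * cj r = 1 \<and> fr r = r \<longrightarrow> r = 1)"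
    and e: "nrm a b c d \<noteq> 0"
  shows "permutes a b c d"
proof -
  let ?B = "val (cj d) (cj c) (cj b) (cj a)" and ?A = "val a b c d"
  have "nrm a b c d = (s * cj s + t * cj t) * (fr (v * cj v + w * cj w) * (v * cj v + w * cj w))"
    using form diag_form_inv(1)[of s t v w a b c d] anti_form_inv(1)[of s t v w a b c d] by auto
  then have st: "s * cj s + t * cj t \<noteq> 0" and vw: "v * cj v + w * cj w \<noteq> 0"
    using e by auto
  have ne: "v * cj v \<noteq> w * cj w" using vw by auto
  define f where "f x = v * x + w" for x
  define h where "h x = cj w * x + cj v" for x
  have nz: "f x \<noteq> 0" "h x \<noteq> 0" if "x \<in> circ" for x
    using mobius_bij(2,3)[OF ne that] by (simp_all add: f_def h_def)
  have cf: "x * cj (f x) = h x" "x * cj (h x) = f x" if "x \<in> circ" for x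
    using that by (simp_all add: f_def h_def circ_iff algebra_simps)
  \<comment> \<open>\<open>F\<close> and \<open>H\<close> hide the difference between the two forms;
    the ratio condition enters only in passing from equal \<open>F / H\<close> to equal
    \<open>f / h\<close>.\<close>
  obtain F H where FH: "\<And>x. ?A x = s * F x + t * H x" "\<And>x. x \<in> circ \<Longrightarrow> ?B x = cj s * H x + cj t * F x"
    and FH0: "\<And>x. x \<in> circ \<Longrightarrow> F x \<noteq> 0" "\<And>x. x \<in> circ \<Longrightarrow> H x \<noteq> 0"
    and FHr: "\<And>x y. x \<in> circ \<Longrightarrow> y \<in> circ \<Longrightarrow> F x * H y = F y * H x \<Longrightarrow> f x * h y = f y * h x"
  proof -
    have unit: "r * cj r = 1" if "x \<in> circ" "y \<in> circ" "r = f x * h y / (f y * h x)" for x y r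
    proof -
      have "cj r = cj (f x * h y / (f y * h x))" using that by simp
      also have "\<dots> = ((x * cj (f x)) * (y * cj (h y))) / ((y * cj (f y)) * (x * cj (h x)))"
        using circ_nz that by simp
      also have "\<dots> = h x * f y / (h y * f x)" unfolding cf[OF that(1)] cf[OF that(2)] ..
      finally have "cj r = h x * f y / (h y * f x)" .
      then show ?thesis unfolding that(3) using nz[OF that(1)] nz[OF that(2)] by simp
    qed
    from form show ?thesis
    proof
      assume *: "diag_form s t v w a b c d \<and> (\<forall>r. r * cj r = 1 \<and> fr r * r = 1 \<longrightarrow> r = 1)"
      let ?F = "\<lambda>x. fr (f x) * f x" and ?H = "\<lambda>x. fr (h x) * h x"
      have A: "?A x = s * ?F x + t * ?H x" for x
        using val_two_term[of a b c d s v w v w t] * by (simp only: f_def h_def diag_form_def)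
      have B: "?B x = cj s * ?H x + cj t * ?F x" if "x \<in> circ" for x
      proof -
        have "?B x = cj s * (fr (x * cj (f x)) * (x * cj (f x))) + cj t * (fr (x * cj (h x)) * (x * cj (h x)))"
          unfolding val_cj[OF that] A by (simp add: algebra_simps)
        then show ?thesis unfolding cf[OF that] .
      qed
      show ?thesis
      proof (rule that[of ?F ?H])
        fix x y assume xy: "x \<in> circ" "y \<in> circ" and eq: "?F x * ?H y = ?F y * ?H x"
        define r where "r = f x * h y / (f y * h x)"
        have "fr r * r = 1" using eq nz xy by (simp add: r_def field_simps)
        then have "r = 1" using unit[OF xy r_def] * by blast
        then show "f x * h y = f y * h x" using nz xy by (simp add: r_def)
      qed (use A B nz in auto)
    next
      assume *: "anti_form s t v w a b c d \<and> (\<forall>r. r * cj r = 1 \<and> fr r = r \<longrightarrow> r = 1)"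
      let ?F = "\<lambda>x. fr (f x) * h x" and ?H = "\<lambda>x. fr (h x) * f x"
      have A: "?A x = s * ?F x + t * ?H x" for x
        using val_two_term[of a b c d s v w "cj w" "cj v" t] * by (simp only: f_def h_def anti_form_def)
      have B: "?B x = cj s * ?H x + cj t * ?F x" if "x \<in> circ" for x
      proof -
        have "?B x = cj s * (fr (x * cj (f x)) * (x * cj (h x))) + cj t * (fr (x * cj (h x)) * (x * cj (f x)))"
          unfolding val_cj[OF that] A by (simp add: algebra_simps)
        then show ?thesis unfolding cf[OF that] .
      qed
      show ?thesis
      proof (rule that[of ?F ?H])
        fix x y assume xy: "x \<in> circ" "y \<in> circ" and eq: "?F x * ?H y = ?F y * ?H x"
        define r where "r = f x * h y / (f y * h x)"
        have "fr r = r" using eq nz xy by (simp add: r_def field_simps)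
        then have "r = 1" using unit[OF xy r_def] * by blast
        then show "f x * h y = f y * h x" using nz xy by (simp add: r_def)
      qed (use A B nz in auto)
    qed
  qed
  show ?thesis
  proof (rule permutesI)
    fix x assume x: "x \<in> circ"
    show "?A x \<noteq> 0"
    proof
      assume A0: "?A x = 0"
      have "?B x = fr x * x * cj (?A x)" by (rule val_cj[OF x])
      then have B0: "?B x = 0" using A0 by simp
      have "(s * cj s + t * cj t) * F x = cj s * ?A x + t * ?B x"
        unfolding FH(1) FH(2)[OF x] by (simp add: algebra_simps)
      then show False using A0 B0 st FH0(1)[OF x] by simp
    qed
  next
    fix x y assume x: "x \<in> circ" and y: "y \<in> circ" and eq: "?B x * ?A y = ?B y * ?A x"
    have "(s * cj s + t * cj t) * (F x * H y + F y * H x) = ?B x * ?A y + ?B y * ?A x"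
      unfolding FH(1) FH(2)[OF x] FH(2)[OF y] by (simp add: algebra_simps)
    also have "\<dots> = 0" unfolding eq by simp
    finally have "F x * H y = F y * H x" using st by (simp add: add_eq_0_iff2)
    then have "f x * h y = f y * h x" by (rule FHr[OF x y])
    moreover have "f x * h y + f y * h x = (v * cj v + w * cj w) * (x + y)"
      by (simp add: f_def h_def algebra_simps)
    ultimately show "x = y" using vw by (simp add: add_eq_0_iff2)
  qed
qed

section \<open>Equivalence of permutation and invariants through normal forms\<close>

definition normal_form where
  "normal_form a b c d \<longleftrightarrow> nrm a b c d \<noteq> 0 \<and>
    ((\<exists>s t v w. split_form s t v w a b c d) \<and> multiplicity 2 k \<le> multiplicity 2 l \<or>
     (\<exists>s t v w. diag_form s t v w a b c d) \<and> multiplicity 2 k \<noteq> multiplicity 2 l \<or>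
     (\<exists>s t v w. anti_form s t v w a b c d) \<and> multiplicity 2 l \<le> multiplicity 2 k)"

lemma permutes_iff_normal_form: "permutes a b c d \<longleftrightarrow> normal_form a b c d"
proof
  assume "normal_form a b c d"
  then show "permutes a b c d" unfolding normal_form_def
    using split_form_permutes nonsplit_form_permutes split_ratio_iff diag_ratio_iff anti_ratio_iff by metis
next
  assume perm: "permutes a b c d"
  show "normal_form a b c d"
  proof (cases "\<exists>u\<in>circ. det_poly a b c d u = 0")
    case True
    then obtain u where u: "u \<in> circ" "det_poly a b c d u = 0" by blast
    \<comment> \<open>Signs are immaterial and \<open>2 = 0\<close>, so the simple-root inequality
      of \<open>split_forms\<close> becomes \<open>nrm \<noteq> 0\<close>.\<close>
    have "nrm a b c d = a * cj a + d * cj d - b * cj b - c * cj c"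
      by (simp add: nrm_def diff_eq algebra_simps)
    then have "nrm a b c d \<noteq> 0" using split_forms(1)[OF perm u] by simp
    moreover obtain s t v w where f: "v * cj w \<noteq> cj v * w" "split_form s t v w a b c d"
      using split_forms(2)[OF perm u] by blast
    moreover have "multiplicity 2 k \<le> multiplicity 2 l"
      unfolding split_ratio_iff[symmetric] using split_ratio_trivial[OF perm f(2,1)] by blast
    ultimately show ?thesis unfolding normal_form_def by blast
  next
    case False
    then obtain u where "u \<notin> circ" "det_poly a b c d u = 0" using ex_det_root by blast
    then obtain s t v w where vw: "v * cj v \<noteq> w * cj w" and st: "s * cj s \<noteq> t * cj t"
      and f: "diag_form s t v w a b c d \<or> anti_form s t v w a b c d"
      using nonsplit_forms[OF perm] by blast
    have "nrm a b c d = (s * cj s + t * cj t) * (fr (v * cj v + w * cj w) * (v * cj v + w * cj w))"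
      using f diag_form_inv(1)[of s t v w a b c d] anti_form_inv(1)[of s t v w a b c d] by auto
    then have e: "nrm a b c d \<noteq> 0" using vw st by (simp add: add_eq_0_iff2 flip: fr_mult)
    from f show ?thesis
    proof
      assume f: "diag_form s t v w a b c d"
      have "multiplicity 2 k \<noteq> multiplicity 2 l"
        unfolding diag_ratio_iff[symmetric] using nonsplit_ratio_trivial[OF perm vw] f circ_iff by blast
      then show ?thesis unfolding normal_form_def using e f by blast
    next
      assume f: "anti_form s t v w a b c d"
      have "multiplicity 2 l \<le> multiplicity 2 k"
        unfolding anti_ratio_iff[symmetric] using nonsplit_ratio_trivial[OF perm vw] f circ_iff by blast
      then show ?thesis unfolding normal_form_def using e f by blast
    qed
  qed
qed

text \<open>\<open>forms_of_invariants\<close> supplies \<open>z\<close>, \<open>h\<close>,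
  \<open>eps\<close>, and the trace condition selects the pairs \<open>h\<close>, \<open>eps\<close>
  that match the valuations.\<close>

lemma invariants_iff_normal_form:
  "nrm a b c d \<noteq> 0 \<and> nrm a b c d * fr (inv1 a b c d) = fr (nrm a b c d) * inv2 a b c d \<and>
    ff_trace (2 ^ pow2_gcd) (k div pow2_gcd) (num b c / nrm a b c d) = of_nat (lcm k l div pow2_gcd) \<longleftrightarrow> normal_form a b c d"
proof -
  have th: "num b c / nrm a b c d = z + fr z + eps" if "invs z h eps a b c d" "nrm a b c d \<noteq> 0" for z h eps
    using that by (simp add: invs_def)
  show ?thesis
  proof
    assume *: "nrm a b c d \<noteq> 0 \<and> nrm a b c d * fr (inv1 a b c d) = fr (nrm a b c d) * inv2 a b c d \<and>
      ff_trace (2 ^ pow2_gcd) (k div pow2_gcd) (num b c / nrm a b c d) = of_nat (lcm k l div pow2_gcd)"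
    then have e: "nrm a b c d \<noteq> 0" by blast
    obtain z h eps where h: "h = 0 \<or> h = 1" and eps: "eps = 0 \<or> eps = 1" and inv: "invs z h eps a b c d"
      and f: "h = 1 \<Longrightarrow> eps = 0 \<Longrightarrow> \<exists>s t v w. split_form s t v w a b c d"
       "h = 0 \<Longrightarrow> eps = 0 \<Longrightarrow> \<exists>s t v w. diag_form s t v w a b c d"
       "h = 0 \<Longrightarrow> eps = 1 \<Longrightarrow> \<exists>s t v w. anti_form s t v w a b c d"
      using forms_of_invariants * by metis
    have "cj z = z + h" using inv by (simp add: invs_def)
    then show "normal_form a b c d"
      using * trace_cond_iff[OF _ h eps, of z] f unfolding th[OF inv e] normal_form_def by blast
  next
    assume *: "normal_form a b c d"
    then have e: "nrm a b c d \<noteq> 0" by (simp add: normal_form_def)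
    have "\<exists>z h eps. invs z h eps a b c d \<and> (h = 1 \<and> eps = 0 \<and> multiplicity 2 k \<le> multiplicity 2 l \<or>
       h = 0 \<and> eps = 0 \<and> multiplicity 2 k \<noteq> multiplicity 2 l \<or>
       h = 0 \<and> eps = 1 \<and> multiplicity 2 l \<le> multiplicity 2 k)"
      using * split_form_invs[OF _ e] nonsplit_form_invs[OF _ e] unfolding normal_form_def by metis
    then obtain z h eps where inv: "invs z h eps a b c d" and
      cases: "(h = 1 \<and> eps = 0 \<and> multiplicity 2 k \<le> multiplicity 2 l \<or>
       h = 0 \<and> eps = 0 \<and> multiplicity 2 k \<noteq> multiplicity 2 l \<or>
       h = 0 \<and> eps = 1 \<and> multiplicity 2 l \<le> multiplicity 2 k)" by blast
    then have h: "h = 0 \<or> h = 1" and eps: "eps = 0 \<or> eps = 1" by auto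
    have "cj z = z + h" using inv by (simp add: invs_def)
    then have "ff_trace (2 ^ pow2_gcd) (k div pow2_gcd) (num b c / nrm a b c d) = of_nat (lcm k l div pow2_gcd)"
      unfolding th[OF inv e] using trace_cond_iff[OF _ h eps, of z] cases by blast
    then show "nrm a b c d \<noteq> 0 \<and> nrm a b c d * fr (inv1 a b c d) = fr (nrm a b c d) * inv2 a b c d \<and>
      ff_trace (2 ^ pow2_gcd) (k div pow2_gcd) (num b c / nrm a b c d) = of_nat (lcm k l div pow2_gcd)"
      using e inv by (simp add: invs_def)
  qed
qed

section \<open>Normalization to the explicit families\<close>

text \<open>With \<open>Y = (w / cj w) * X\<close>, taking out \<open>cj w\<close> leaves the
  factors \<open>al * Y + cj al\<close> and \<open>Y + 1\<close>, where \<open>al = v / w\<close>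
  and \<open>be = t / s\<close>. Nondegeneracy puts \<open>al\<close> and \<open>be\<close> outside
  F_q. Conversely, Hilbert 90 writes \<open>g\<close> as \<open>cj m / m\<close>.\<close>

lemma split_form_normalize:
  "(\<exists>s t v w. split_form s t v w a b c d) \<and> nrm a b c d \<noteq> 0 \<longleftrightarrow>
   (\<exists>g\<in>circ. \<exists>e. e \<noteq> 0 \<and> (\<exists>al be. cj al \<noteq> al \<and> cj be \<noteq> be \<and>
     rescaled e g (fr al * al + be) (cj al * fr al + be) (fr (cj al) * al + be) (fr (cj al) * cj al + be) a b c d))"
proof
  assume "(\<exists>s t v w. split_form s t v w a b c d) \<and> nrm a b c d \<noteq> 0"
  then obtain s t v w where f: "split_form s t v w a b c d" and e: "nrm a b c d \<noteq> 0" by blast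
  have nz: "s * cj t + cj s * t \<noteq> 0" "v * cj w + cj v * w \<noteq> 0"
    using split_form_inv(1)[OF f] e by auto
  then have s: "s \<noteq> 0" and w: "w \<noteq> 0" by auto
  have "w / cj w \<in> circ" using w by (simp add: circ_iff)
  moreover have "s * (fr (cj w) * cj w) \<noteq> 0" using s w by simp
  moreover have "cj (v / w) \<noteq> v / w" "cj (t / s) \<noteq> t / s"
    using nz s w by (auto simp: field_simps)
  moreover have "rescaled (s * (fr (cj w) * cj w)) (w / cj w) (fr (v / w) * (v / w) + t / s)
     (cj (v / w) * fr (v / w) + t / s) (fr (cj (v / w)) * (v / w) + t / s) (fr (cj (v / w)) * cj (v / w) + t / s) a b c d"
    unfolding rescaled_def two_termD[OF f[unfolded split_form_def]] using s w by (simp add: field_simps)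
  ultimately show "\<exists>g\<in>circ. \<exists>e. e \<noteq> 0 \<and> (\<exists>al be. cj al \<noteq> al \<and> cj be \<noteq> be \<and>
     rescaled e g (fr al * al + be) (cj al * fr al + be) (fr (cj al) * al + be) (fr (cj al) * cj al + be) a b c d)"
    by blast
next
  assume "\<exists>g\<in>circ. \<exists>e. e \<noteq> 0 \<and> (\<exists>al be. cj al \<noteq> al \<and> cj be \<noteq> be \<and>
     rescaled e g (fr al * al + be) (cj al * fr al + be) (fr (cj al) * al + be) (fr (cj al) * cj al + be) a b c d)"
  then obtain g e al be where g: "g \<in> circ" "e \<noteq> 0" "cj al \<noteq> al" "cj be \<noteq> be" and
    r: "rescaled e g (fr al * al + be) (cj al * fr al + be) (fr (cj al) * al + be) (fr (cj al) * cj al + be) a b c d"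
    by blast
  obtain m where m: "m \<noteq> 0" "cj m = g * m" using hilbert90[of g] g(1) by (auto simp: circ_iff)
  define n where "n = fr m * m"
  have n: "n \<noteq> 0" using m by (simp add: n_def)
  have gm: "g = cj m / m" using m by simp
  have f: "split_form (e / n) (e * be / n) (al * cj m) (cj m) a b c d"
    unfolding split_form_def two_term_def using r m(1) unfolding rescaled_def gm n_def
    by (simp add: field_simps)
  moreover have "nrm a b c d \<noteq> 0"
  proof -
    have "(e / n) * cj (e * be / n) + cj (e / n) * (e * be / n) = (e * cj e / (n * cj n)) * (be + cj be)"
      using n by (simp add: field_simps)
    then have 1: "(e / n) * cj (e * be / n) + cj (e / n) * (e * be / n) \<noteq> 0"
      using g n by (auto simp: add_eq_0_iff2)
    have "al * cj m * cj (cj m) + cj (al * cj m) * cj m = m * cj m * (al + cj al)"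
      by (simp add: algebra_simps)
    then have 2: "al * cj m * cj (cj m) + cj (al * cj m) * cj m \<noteq> 0"
      using g m by (auto simp: add_eq_0_iff2)
    show ?thesis unfolding split_form_inv(1)[OF f] using 1 2 by (simp del: cj_mult cj_divide fr_add fr_mult cj_cj)
  qed
  ultimately show "(\<exists>s t v w. split_form s t v w a b c d) \<and> nrm a b c d \<noteq> 0" by blast
qed

text \<open>Taking out \<open>w\<close> and \<open>cj w\<close> leaves the factors
  \<open>cj al * X + 1\<close> and \<open>X + al\<close>, with \<open>al = cj v / cj w\<close>;
  nondegeneracy keeps \<open>al\<close> and \<open>be\<close> off \<open>circ\<close>.\<close>

lemma diag_form_normalize:
  "(\<exists>s t v w. diag_form s t v w a b c d) \<and> nrm a b c d \<noteq> 0 \<longleftrightarrow>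
   (\<exists>g\<in>circ. \<exists>e. e \<noteq> 0 \<and> (rescaled e g 1 0 0 0 a b c d \<or> (\<exists>al be. al \<notin> circ \<and> be \<notin> circ \<and>
     rescaled e g (fr (cj al) * cj al + be) (fr (cj al) + al * be) (cj al + fr al * be) (1 + fr al * al * be) a b c d)))"
  (is "?L \<longleftrightarrow> ?R")
proof
  assume ?L
  then obtain s t v w where f: "diag_form s t v w a b c d" and e: "nrm a b c d \<noteq> 0" by blast
  have direct: ?R if f: "diag_form s t v w a b c d" and s: "s \<noteq> 0" and w: "w \<noteq> 0" for s t v w
  proof -
    have nz: "s * cj s + t * cj t \<noteq> 0" "v * cj v + w * cj w \<noteq> 0"
      using diag_form_inv(1)[OF f] e by auto
    define al where "al = cj v / cj w"
    define be where "be = t * (fr (cj w) * cj w) / (s * (fr w * w))"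
    have "s * (fr w * w) \<noteq> 0" using s w by simp
    moreover have "al \<notin> circ" using nz w by (auto simp: al_def circ_iff field_simps)
    moreover have "be * cj be = t * cj t / (s * cj s)" using s w by (simp add: be_def field_simps)
    then have "be \<notin> circ" using nz s by (auto simp: circ_iff)
    moreover have "rescaled (s * (fr w * w)) 1 (fr (cj al) * cj al + be) (fr (cj al) + al * be)
        (cj al + fr al * be) (1 + fr al * al * be) a b c d"
      unfolding rescaled_def two_termD[OF f[unfolded diag_form_def]] al_def be_def using s w by (simp add: field_simps)
    ultimately show ?R using circ_closed(6) by blast
  qed
  have nz: "s * cj s + t * cj t \<noteq> 0" "v * cj v + w * cj w \<noteq> 0"
    using diag_form_inv(1)[OF f] e by auto
  \<comment> \<open>If \<open>s\<close> or \<open>w\<close> vanishes, the two terms are exchanged;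
    if that fails too, \<open>A\<close> is a monomial.\<close>
  consider "s \<noteq> 0" "w \<noteq> 0" | "t \<noteq> 0" "v \<noteq> 0" | "s = 0 \<and> v = 0 \<or> t = 0 \<and> w = 0"
    using nz by fastforce
  then show ?R
  proof cases
    case 1
    then show ?thesis by (rule direct[OF f])
  next
    case 2
    have "diag_form t s (cj w) (cj v) a b c d"
      using f by (simp add: diag_form_def two_term_def add.commute)
    then show ?thesis by (rule direct) (use 2 in auto)
  next
    case 3
    then have bcd: "b = 0" "c = 0" "d = 0" using f by (auto simp: diag_form_def two_term_def)
    then have "a \<noteq> 0" using e by (auto simp: nrm_def)
    moreover have "rescaled a 1 1 0 0 0 a b c d" using bcd by (simp add: rescaled_def)
    ultimately show ?thesis using circ_closed(6) by blast
  qed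
next
  assume ?R
  then obtain g e where g: "g \<in> circ" and e: "e \<noteq> 0" and
    *: "rescaled e g 1 0 0 0 a b c d \<or> (\<exists>al be. al \<notin> circ \<and> be \<notin> circ \<and>
     rescaled e g (fr (cj al) * cj al + be) (fr (cj al) + al * be) (cj al + fr al * be) (1 + fr al * al * be) a b c d)"
    by blast
  from * show ?L
  proof
    assume "rescaled e g 1 0 0 0 a b c d"
    then have "a = e * (fr g * g)" "b = 0" "c = 0" "d = 0" by (simp_all add: rescaled_def)
    moreover from this have "diag_form a 0 1 0 a b c d" by (simp add: diag_form_def two_term_def)
    ultimately show ?L using e circ_nz[OF g] by (auto simp: nrm_def)
  next
    assume "\<exists>al be. al \<notin> circ \<and> be \<notin> circ \<and>
     rescaled e g (fr (cj al) * cj al + be) (fr (cj al) + al * be) (cj al + fr al * be) (1 + fr al * al * be) a b c d"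
    then obtain al be where ab: "al \<notin> circ" "be \<notin> circ" and
      r: "rescaled e g (fr (cj al) * cj al + be) (fr (cj al) + al * be) (cj al + fr al * be) (1 + fr al * al * be) a b c d"
      by blast
    have g1: "g * cj g = 1" "fr g * fr (cj g) = 1" using g circ_closed(1)[OF g] by (simp_all add: circ_iff)
    have g2: "g * (cj g * x) = x" "fr g * (fr (cj g) * x) = x" for x
      using g1 by (simp_all flip: mult.assoc)
    \<comment> \<open>\<open>g * X + al\<close> is \<open>g\<close> times the conjugate reciprocal
      of \<open>cj al * g * X + 1\<close>, whence the factor \<open>fr g * g\<close>.\<close>
    have f: "diag_form e (e * be * (fr g * g)) (cj al * g) 1 a b c d"
      unfolding diag_form_def two_term_def using r unfolding rescaled_def by (simp add: algebra_simps g1 g2)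
    moreover have "nrm a b c d \<noteq> 0"
    proof -
      have "e * cj e + (e * be * (fr g * g)) * cj (e * be * (fr g * g)) = e * cj e * (1 + be * cj be)"
        by (simp add: algebra_simps g1 g2)
      then have 1: "e * cj e + (e * be * (fr g * g)) * cj (e * be * (fr g * g)) \<noteq> 0"
        using ab e by (auto simp: add_eq_0_iff2 circ_iff)
      have "(cj al * g) * cj (cj al * g) + 1 * cj 1 = al * cj al + 1"
        by (simp add: algebra_simps g1 g2)
      then have 2: "(cj al * g) * cj (cj al * g) + 1 * cj 1 \<noteq> 0"
        using ab by (metis add_eq_0_iff2 circ_iff)
      show ?thesis unfolding diag_form_inv(1)[OF f] using 1 2 by (simp del: cj_mult cj_divide fr_add fr_mult cj_cj)
    qed
    ultimately show ?L by blast
  qed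
qed

text \<open>The extraction of \<open>diag_form_normalize\<close> with mixed factors; the degenerate
  case is now \<open>X ^ Q\<close>.\<close>

lemma anti_form_normalize:
  "(\<exists>s t v w. anti_form s t v w a b c d) \<and> nrm a b c d \<noteq> 0 \<longleftrightarrow>
   (\<exists>g\<in>circ. \<exists>e. e \<noteq> 0 \<and> (rescaled e g 0 1 0 0 a b c d \<or> (\<exists>al be. al \<notin> circ \<and> be \<notin> circ \<and>
     rescaled e g (fr (cj al) + cj al * be) (fr (cj al) * al + be) (1 + cj al * fr al * be) (al + fr al * be) a b c d)))"
  (is "?L \<longleftrightarrow> ?R")
proof
  assume ?L
  then obtain s t v w where f: "anti_form s t v w a b c d" and e: "nrm a b c d \<noteq> 0" by blast
  have direct: ?R if f: "anti_form s t v w a b c d" and s: "s \<noteq> 0" and w: "w \<noteq> 0" for s t v w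
  proof -
    have nz: "s * cj s + t * cj t \<noteq> 0" "v * cj v + w * cj w \<noteq> 0"
      using anti_form_inv(1)[OF f] e by auto
    define al where "al = cj v / cj w"
    define be where "be = t * (fr (cj w) * w) / (s * (fr w * cj w))"
    have "s * (fr w * cj w) \<noteq> 0" using s w by simp
    moreover have "al \<notin> circ" using nz w by (auto simp: al_def circ_iff field_simps)
    moreover have "be * cj be = t * cj t / (s * cj s)" using s w by (simp add: be_def field_simps)
    then have "be \<notin> circ" using nz s by (auto simp: circ_iff)
    moreover have "rescaled (s * (fr w * cj w)) 1 (fr (cj al) + cj al * be) (fr (cj al) * al + be)
        (1 + cj al * fr al * be) (al + fr al * be) a b c d"
      unfolding rescaled_def two_termD[OF f[unfolded anti_form_def]] al_def be_def using s w by (simp add: field_simps)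
    ultimately show ?R using circ_closed(6) by blast
  qed
  have nz: "s * cj s + t * cj t \<noteq> 0" "v * cj v + w * cj w \<noteq> 0"
    using anti_form_inv(1)[OF f] e by auto
  consider "s \<noteq> 0" "w \<noteq> 0" | "t \<noteq> 0" "v \<noteq> 0" | "s = 0 \<and> v = 0 \<or> t = 0 \<and> w = 0"
    using nz by fastforce
  then show ?R
  proof cases
    case 1
    then show ?thesis by (rule direct[OF f])
  next
    case 2
    have "anti_form t s (cj w) (cj v) a b c d"
      using f by (simp add: anti_form_def two_term_def add.commute)
    then show ?thesis by (rule direct) (use 2 in auto)
  next
    case 3
    then have acd: "a = 0" "c = 0" "d = 0" using f by (auto simp: anti_form_def two_term_def)
    then have "b \<noteq> 0" using e by (auto simp: nrm_def)
    moreover have "rescaled b 1 0 1 0 0 a b c d" using acd by (simp add: rescaled_def)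
    ultimately show ?thesis using circ_closed(6) by blast
  qed
next
  assume ?R
  then obtain g e where g: "g \<in> circ" and e: "e \<noteq> 0" and
    *: "rescaled e g 0 1 0 0 a b c d \<or> (\<exists>al be. al \<notin> circ \<and> be \<notin> circ \<and>
     rescaled e g (fr (cj al) + cj al * be) (fr (cj al) * al + be) (1 + cj al * fr al * be) (al + fr al * be) a b c d)"
    by blast
  from * show ?L
  proof
    assume "rescaled e g 0 1 0 0 a b c d"
    then have "b = e * fr g" "a = 0" "c = 0" "d = 0" by (simp_all add: rescaled_def)
    moreover from this have "anti_form b 0 1 0 a b c d" by (simp add: anti_form_def two_term_def)
    ultimately show ?L using e circ_nz[OF g] by (auto simp: nrm_def)
  next
    assume "\<exists>al be. al \<notin> circ \<and> be \<notin> circ \<and>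
     rescaled e g (fr (cj al) + cj al * be) (fr (cj al) * al + be) (1 + cj al * fr al * be) (al + fr al * be) a b c d"
    then obtain al be where ab: "al \<notin> circ" "be \<notin> circ" and
      r: "rescaled e g (fr (cj al) + cj al * be) (fr (cj al) * al + be) (1 + cj al * fr al * be) (al + fr al * be) a b c d"
      by blast
    have g1: "g * cj g = 1" "fr g * fr (cj g) = 1" using g circ_closed(1)[OF g] by (simp_all add: circ_iff)
    have g2: "g * (cj g * x) = x" "fr g * (fr (cj g) * x) = x" for x
      using g1 by (simp_all flip: mult.assoc)
    have f: "anti_form (e * g) (e * be * fr g) (cj al * g) 1 a b c d"
      unfolding anti_form_def two_term_def using r unfolding rescaled_def by (simp add: algebra_simps g1 g2)
    moreover have "nrm a b c d \<noteq> 0"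
    proof -
      have "(e * g) * cj (e * g) + (e * be * fr g) * cj (e * be * fr g) = e * cj e * (1 + be * cj be)"
        by (simp add: algebra_simps g1 g2)
      then have 1: "(e * g) * cj (e * g) + (e * be * fr g) * cj (e * be * fr g) \<noteq> 0"
        using ab e by (auto simp: add_eq_0_iff2 circ_iff)
      have "(cj al * g) * cj (cj al * g) + 1 * cj 1 = al * cj al + 1"
        by (simp add: algebra_simps g1 g2)
      then have 2: "(cj al * g) * cj (cj al * g) + 1 * cj 1 \<noteq> 0"
        using ab by (metis add_eq_0_iff2 circ_iff)
      show ?thesis unfolding anti_form_inv(1)[OF f] using 1 2 by (simp del: cj_mult cj_divide fr_add fr_mult cj_cj)
    qed
    ultimately show ?L by blast
  qed
qed

section \<open>The families as polynomials and the final equivalences\<close>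

lemma split_form_poly:
  "(\<exists>s t v w. split_form s t v w a b c d) \<and> nrm a b c d \<noteq> 0 \<longleftrightarrow>
   (\<exists>\<gamma> \<in> mu (q + 1). \<exists>\<delta>. \<delta> \<noteq> 0 \<and> (\<exists>A0.
        quadrinomial Q a b c d = smult \<delta> (pcompose A0 [:0, \<gamma>:]) \<and>
          (\<exists>\<alpha> \<beta>. \<alpha> \<notin> subfield_of_order q \<and> \<beta> \<notin> subfield_of_order q \<and>
            A0 = quadrinomial Q
              (\<alpha> ^ (Q + 1) + \<beta>)
              (\<alpha> ^ (q + Q) + \<beta>)
              (\<alpha> ^ (q * Q + 1) + \<beta>)
              (\<alpha> ^ (q * Q + q) + \<beta>))))"
  unfolding split_form_normalize mu_eq K_iff exponents quadrinomial_rescaled_iff[symmetric] by blast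

lemma diag_form_poly:
  "(\<exists>s t v w. diag_form s t v w a b c d) \<and> nrm a b c d \<noteq> 0 \<longleftrightarrow>
   (\<exists>\<gamma> \<in> mu (q + 1). \<exists>\<delta>. \<delta> \<noteq> 0 \<and> (\<exists>A0.
        quadrinomial Q a b c d = smult \<delta> (pcompose A0 [:0, \<gamma>:]) \<and>
          (A0 = monom 1 (Q + 1) \<or>
           (\<exists>\<alpha> \<beta>. \<alpha> \<notin> mu (q + 1) \<and> \<beta> \<notin> mu (q + 1) \<and>
            A0 = quadrinomial Q
              (\<alpha> ^ (q * Q + q) + \<beta>)
              (\<alpha> ^ (q * Q) + \<alpha> * \<beta>)
              (\<alpha> ^ q + \<alpha> ^ Q * \<beta>)
              (1 + \<alpha> ^ (Q + 1) * \<beta>)))))"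
proof -
  have 1: "monom 1 (Q + 1) = quadrinomial Q 1 0 0 (0::'a)" by (simp add: quadrinomial_def)
  show ?thesis
    unfolding diag_form_normalize mu_eq exponents 1 quadrinomial_rescaled_iff[symmetric] by blast
qed

lemma anti_form_poly:
  "(\<exists>s t v w. anti_form s t v w a b c d) \<and> nrm a b c d \<noteq> 0 \<longleftrightarrow>
   (\<exists>\<gamma> \<in> mu (q + 1). \<exists>\<delta>. \<delta> \<noteq> 0 \<and> (\<exists>A0.
        quadrinomial Q a b c d = smult \<delta> (pcompose A0 [:0, \<gamma>:]) \<and>
          (A0 = monom 1 Q \<or>
           (\<exists>\<alpha> \<beta>. \<alpha> \<notin> mu (q + 1) \<and> \<beta> \<notin> mu (q + 1) \<and>
            A0 = quadrinomial Q
              (\<alpha> ^ (q * Q) + \<alpha> ^ q * \<beta>)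
              (\<alpha> ^ (q * Q + 1) + \<beta>)
              (1 + \<alpha> ^ (q + Q) * \<beta>)
              (\<alpha> + \<alpha> ^ Q * \<beta>)))))"
proof -
  have 1: "monom 1 Q = quadrinomial Q 0 1 0 (0::'a)" by (simp add: quadrinomial_def)
  show ?thesis
    unfolding anti_form_normalize mu_eq exponents 1 quadrinomial_rescaled_iff[symmetric] by blast
qed

lemma normal_form_iff_invariants:
  assumes "e = a ^ (q + 1) + b ^ (q + 1) + c ^ (q + 1) + d ^ (q + 1)"
  shows "normal_form a b c d \<longleftrightarrow> e \<noteq> 0 \<and>
      (a * b ^ q + c * d ^ q) ^ Q = e ^ (Q - 1) * (a * c ^ q + b * d ^ q) \<and>
      ff_trace (2 ^ pow2_gcd) (k div pow2_gcd) ((b ^ (q + 1) + c ^ (q + 1)) / e) = of_nat (lcm k l div pow2_gcd)"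
proof -
  have e: "e = nrm a b c d" using assms by (simp only: exponents nrm_def)
  have num: "b ^ (q + 1) + c ^ (q + 1) = num b c" by (simp only: exponents num_def)
  \<comment> \<open>Multiplying by \<open>e\<close> turns \<open>e ^ (Q - 1)\<close> into
    \<open>fr e\<close>; the subtraction does not truncate since \<open>Q\<close> is at least
    2.\<close>
  have "fr e = e * e ^ (Q - 1)" using Q_ge_2 by (simp add: fr_def flip: power_Suc)
  then have iff: "fr (inv1 a b c d) = e ^ (Q - 1) * inv2 a b c d \<longleftrightarrow>
      e * fr (inv1 a b c d) = fr e * inv2 a b c d" if "e \<noteq> 0"
    using that by (simp add: mult.assoc)
  have "(a * b ^ q + c * d ^ q) ^ Q = e ^ (Q - 1) * (a * c ^ q + b * d ^ q) \<longleftrightarrow>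
      e * fr (inv1 a b c d) = fr e * inv2 a b c d" if "e \<noteq> 0"
    using iff[OF that] by (simp only: exponents inv1_def inv2_def)
  then show ?thesis unfolding num invariants_iff_normal_form[symmetric] e[symmetric] by blast
qed

end

theorem theorem1p3:
  fixes p k l q Q m :: nat
    and a b c d e :: "'a::finite_field"
    and A B :: "'a poly"
  assumes "prime p" and "k > 0" and "l > 0"
    and q_def: "q = p ^ k" and Q_def: "Q = p ^ l"
    and "CARD('a) = q ^ 2"
    and "\<not> (a = 0 \<and> b = 0 \<and> c = 0 \<and> d = 0)"
    and A_def: "A = quadrinomial Q a b c d"
    and B_def: "B = quadrinomial Q (d ^ q) (c ^ q) (b ^ q) (a ^ q)"
    and e_def: "e = a ^ (q + 1) + b ^ (q + 1) + c ^ (q + 1) + d ^ (q + 1)"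
    and m_def: "m = max_pow2_dvd (gcd k l)"
  defines "cond1 \<equiv>
      (\<forall>x \<in> mu (q + 1). poly A x \<noteq> 0) \<and>
      bij_betw (\<lambda>x. poly B x / poly A x) (mu (q + 1)) (mu (q + 1))"
    and "cond2 \<equiv>
      p = 2 \<and> e \<noteq> 0 \<and>
      (a * b ^ q + c * d ^ q) ^ Q = e ^ (Q - 1) * (a * c ^ q + b * d ^ q) \<and>
      ff_trace (2 ^ m) (k div m) ((b ^ (q + 1) + c ^ (q + 1)) / e) = of_nat (lcm k l div m)"
    and "cond3 \<equiv>
      p = 2 \<and>
      (\<exists>\<gamma> \<in> mu (q + 1). \<exists>\<delta>. \<delta> \<noteq> 0 \<and> (\<exists>A0 :: 'a poly.
        A = smult \<delta> (pcompose A0 [:0, \<gamma>:]) \<and>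
        ((multiplicity 2 k \<le> multiplicity 2 l \<and>
          (\<exists>\<alpha> \<beta>. \<alpha> \<notin> subfield_of_order q \<and> \<beta> \<notin> subfield_of_order q \<and>
            A0 = quadrinomial Q
              (\<alpha> ^ (Q + 1) + \<beta>)
              (\<alpha> ^ (q + Q) + \<beta>)
              (\<alpha> ^ (q * Q + 1) + \<beta>)
              (\<alpha> ^ (q * Q + q) + \<beta>)))
        \<or> (multiplicity 2 k \<noteq> multiplicity 2 l \<and>
          (A0 = monom 1 (Q + 1) \<or>
           (\<exists>\<alpha> \<beta>. \<alpha> \<notin> mu (q + 1) \<and> \<beta> \<notin> mu (q + 1) \<and>
            A0 = quadrinomial Q
              (\<alpha> ^ (q * Q + q) + \<beta>)
              (\<alpha> ^ (q * Q) + \<alpha> * \<beta>)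
              (\<alpha> ^ q + \<alpha> ^ Q * \<beta>)
              (1 + \<alpha> ^ (Q + 1) * \<beta>))))
        \<or> (multiplicity 2 k \<ge> multiplicity 2 l \<and>
          (A0 = monom 1 Q \<or>
           (\<exists>\<alpha> \<beta>. \<alpha> \<notin> mu (q + 1) \<and> \<beta> \<notin> mu (q + 1) \<and>
            A0 = quadrinomial Q
              (\<alpha> ^ (q * Q) + \<alpha> ^ q * \<beta>)
              (\<alpha> ^ (q * Q + 1) + \<beta>)
              (1 + \<alpha> ^ (q + Q) * \<beta>)
              (\<alpha> + \<alpha> ^ Q * \<beta>)))))))"
  shows "(cond1 \<longleftrightarrow> cond2) \<and> (cond2 \<longleftrightarrow> cond3)"
proof -
  interpret quadratic_ext p k l q Q "TYPE('a)"
    using assms by unfold_locales auto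
  have c1: "cond1 \<longleftrightarrow> permutes a b c d"
    unfolding cond1_def A_def B_def by (rule permutes_iff[symmetric])
  show ?thesis
  proof (cases "p = 2")
    case False
    then show ?thesis using permutes_imp_char_2 unfolding c1 cond2_def cond3_def by blast
  next
    case True
    interpret quadratic_ext_2 p k l q Q "TYPE('a)"
      using True by unfold_locales
    have "cond2 \<longleftrightarrow> normal_form a b c d"
      unfolding normal_form_iff_invariants[OF e_def] cond2_def pow2_gcd_def m_def using True by blast
    moreover have "cond3 \<longleftrightarrow> normal_form a b c d"
    proof -
      \<comment> \<open>Distributing \<open>nrm \<noteq> 0\<close> over the alternatives matches
        each with one family.\<close>
      have "normal_form a b c d \<longleftrightarrow>
        ((\<exists>s t v w. split_form s t v w a b c d) \<and> nrm a b c d \<noteq> 0) \<and> multiplicity 2 k \<le> multiplicity 2 l \<or>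
        ((\<exists>s t v w. diag_form s t v w a b c d) \<and> nrm a b c d \<noteq> 0) \<and> multiplicity 2 k \<noteq> multiplicity 2 l \<or>
        ((\<exists>s t v w. anti_form s t v w a b c d) \<and> nrm a b c d \<noteq> 0) \<and> multiplicity 2 l \<le> multiplicity 2 k"
        unfolding normal_form_def by blast
      then show ?thesis
        unfolding split_form_poly diag_form_poly anti_form_poly cond3_def A_def using True by blast
    qed
    ultimately show ?thesis using c1 permutes_iff_normal_form by blast
  qed
qed

end
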